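(* Let $T>0$ be fixed and let $\alpha:[0,T)\to\mathbb{R}$ be a continuous function such that $\lim_{t\uparrow T}\alpha(t)\ne 1$ (that is, it is not the case that the limit exists and equals $1$). Then there does not exist an Ornstein-Uhlenbeck type process $(Z_t)_{t\geq 0}$ (given by the SDE $\mathrm{d}Z_t=q(t)Z_t\,\mathrm{d}t+\sigma(t)\,\mathrm{d}B_t$, $t\geq 0$, with $q,\sigma$ as in the context) such that the law of the Ornstein-Uhlenbeck type bridge from $0$ to $0$ over the time-interval $[0,T]$ derived from $Z$ coincides with the law of the general $\alpha$-Wiener bridge.
   Context: Ornstein-Uhlenbeck type process: the strong solution $(Z_t)_{t\ge0}$ of $\mathrm{d}Z_t=q(t)Z_t\,\mathrm{d}t+\sigma(t)\,\mathrm{d}B_t$, $t\ge 0$, where $q:[0,\infty)\to\mathbb{R}$ and $\sigma:[0,\infty)\to\mathbb{R}$ are continuous functions with $\sigma(t)\neq0$ for all $t\ge0$, $(B_t)_{t\ge0}$ is a one-dimensional standard Wiener process, and the initial value $Z_0$ has a Gauss (Gaussian, possibly degenerate) distribution and is independent of $B$. Put $\bar q(t):=\int_0^t q(u)\,\mathrm{d}u$ and $\gamma(s,t):=\int_s^t e^{2(\bar q(t)-\bar q(u))}\sigma^2(u)\,\mathrm{d}u$ for $0\le s\le t$. The bridge of Ornstein-Uhlenbeck type from $0$ to $0$ over $[0,T]$ derived from $Z$ is the process $$U_t=\int_0^t\frac{\gamma(t,T)}{\gamma(s,T)}e^{\bar q(t)-\bar q(s)}\sigma(s)\,\mathrm{d}B_s,\quad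 t\in[0,T),\qquad U_T=0,$$ which is an almost surely continuous Gauss process on $[0,T]$, or more generally any almost surely continuous process on $[0,T]$ having the same finite-dimensional distributions. For a continuous function $\alpha:[0,T)\to\mathbb{R}$, the general $\alpha$-Wiener bridge is the unique strong solution $(X_t)_{t\in[0,T)}$ of $\mathrm{d}X_t=-\frac{\alpha(t)}{T-t}X_t\,\mathrm{d}t+\mathrm{d}B_t$, $t\in[0,T)$, $X_0=0$, namely $X_t=\int_0^t\exp\{-\int_s^t\frac{\alpha(u)}{T-u}\mathrm{d}u\}\,\mathrm{d}B_s$, $t\in[0,T)$, or more generally any almost surely continuous process on $[0,T)$ with the same finite-dimensional distributions. The laws of the bridge and of the general $\alpha$-Wiener bridge coincide if the two processes have the same finite-dimensional distributions on $[0,T)$. *)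

theory Defs
  imports "HOL-Probability.Probability"
begin

text \<open>
  A stochastic process indexed by a set \<open>I\<close> of times is a function of type
  \<open>real \<Rightarrow> 'a \<Rightarrow> real\<close> of which only the values at times in \<open>I\<close> matter.
\<close>

definition process_on :: "real set \<Rightarrow> 'a measure \<Rightarrow> (real \<Rightarrow> 'a \<Rightarrow> real) \<Rightarrow> bool" where
  "process_on I M X \<longleftrightarrow> prob_space M \<and> (\<forall>t\<in>I. X t \<in> borel_measurable M)"

definition ae_continuous_on :: "real set \<Rightarrow> 'a measure \<Rightarrow> (real \<Rightarrow> 'a \<Rightarrow> real) \<Rightarrow> bool" where
  "ae_continuous_on I M X \<longleftrightarrow> (AE \<omega> in M. continuous_on I (\<lambda>t. X t \<omega>))"

definition same_fdd ::
    "real set \<Rightarrow> 'a measure \<Rightarrow> (real \<Rightarrow> 'a \<Rightarrow> real) \<Rightarrow> 'b measure \<Rightarrow> (real \<Rightarrow> 'b \<Rightarrow> real) \<Rightarrow> bool" where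
  "same_fdd I M X N Y \<longleftrightarrow>
     (\<forall>J. finite J \<and> J \<subseteq> I \<longrightarrow>
        distr M (PiM J (\<lambda>_. borel)) (\<lambda>\<omega>. \<lambda>t\<in>J. X t \<omega>) =
        distr N (PiM J (\<lambda>_. borel)) (\<lambda>\<omega>. \<lambda>t\<in>J. Y t \<omega>))"

definition wiener_process :: "'a measure \<Rightarrow> (real \<Rightarrow> 'a \<Rightarrow> real) \<Rightarrow> bool" where
  "wiener_process M B \<longleftrightarrow>
     process_on {0..} M B \<and>
     (AE \<omega> in M. B 0 \<omega> = 0) \<and>
     (\<forall>s t. 0 \<le> s \<and> s < t \<longrightarrow>
        distributed M lborel (\<lambda>\<omega>. B t \<omega> - B s \<omega>) (normal_density 0 (sqrt (t - s)))) \<and>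
     (\<forall>(n::nat) (t::nat \<Rightarrow> real). 0 \<le> t 0 \<and> (\<forall>i<n. t i \<le> t (Suc i)) \<longrightarrow>
        prob_space.indep_vars M (\<lambda>_. borel) (\<lambda>i \<omega>. B (t (Suc i)) \<omega> - B (t i) \<omega>) {..<n}) \<and>
     ae_continuous_on {0..} M B"


text \<open>
  The integral of a deterministic function against a Wiener process.  A step function
  \<open>\<Sum>i<n. c i * indicator {t i<..t (Suc i)}\<close> with \<open>a \<le> t 0 \<le> \<dots> \<le> t n \<le> b\<close> is given by
  \<open>(n, t, c)\<close>; its integral is \<open>\<Sum>i<n. c i * (B (t (Suc i)) - B (t i))\<close>.  A random variable
  is an integral of \<open>f\<close> over \<open>[a, b]\<close> if it is the \<open>L\<^sup>2(M)\<close>-limit of the integrals of step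
  functions that converge to \<open>f\<close> in \<open>L\<^sup>2([a, b])\<close>.  By the isometry of the integral it is
  determined by \<open>f\<close> up to almost sure equality, which is why the integral is a relation
  rather than a function here.
\<close>

definition step_grid :: "real \<Rightarrow> real \<Rightarrow> nat \<Rightarrow> (nat \<Rightarrow> real) \<Rightarrow> bool" where
  "step_grid a b n t \<longleftrightarrow> a \<le> t 0 \<and> (\<forall>i<n. t i \<le> t (Suc i)) \<and> t n \<le> b"

definition step_fun :: "nat \<Rightarrow> (nat \<Rightarrow> real) \<Rightarrow> (nat \<Rightarrow> real) \<Rightarrow> real \<Rightarrow> real" where
  "step_fun n t c u = (\<Sum>i<n. c i * indicator {t i<..t (Suc i)} u)"

definition step_integral ::
    "(real \<Rightarrow> 'a \<Rightarrow> real) \<Rightarrow> nat \<Rightarrow> (nat \<Rightarrow> real) \<Rightarrow> (nat \<Rightarrow> real) \<Rightarrow> 'a \<Rightarrow> real" where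
  "step_integral B n t c \<omega> = (\<Sum>i<n. c i * (B (t (Suc i)) \<omega> - B (t i) \<omega>))"

definition has_wiener_integral ::
    "'a measure \<Rightarrow> (real \<Rightarrow> 'a \<Rightarrow> real) \<Rightarrow> (real \<Rightarrow> real) \<Rightarrow> real \<Rightarrow> real \<Rightarrow> ('a \<Rightarrow> real) \<Rightarrow> bool" where
  "has_wiener_integral M B f a b J \<longleftrightarrow>
     J \<in> borel_measurable M \<and>
     set_borel_measurable lborel {a..b} f \<and>
     (\<exists>(n::nat \<Rightarrow> nat) (t::nat \<Rightarrow> nat \<Rightarrow> real) (c::nat \<Rightarrow> nat \<Rightarrow> real).
        (\<forall>k. step_grid a b (n k) (t k)) \<and>
        (\<lambda>k. \<integral>\<^sup>+u\<in>{a..b}. ennreal ((f u - step_fun (n k) (t k) (c k) u)\<^sup>2) \<partial>lborel)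
          \<longlonglongrightarrow> 0 \<and>
        (\<lambda>k. \<integral>\<^sup>+\<omega>. ennreal ((J \<omega> - step_integral B (n k) (t k) (c k) \<omega>)\<^sup>2) \<partial>M)
          \<longlonglongrightarrow> 0)"


text \<open>
  Strong solutions of the linear equation \<open>dY\<^sub>t = a(t) Y\<^sub>t dt + b(t) dB\<^sub>t\<close> on a time interval
  \<open>I\<close> with left endpoint \<open>0\<close>, adapted to the filtration generated by \<open>Y\<^sub>0\<close>, \<open>B\<close> and the
  null sets.  As \<open>b\<close> is deterministic, the integral above suffices to state the equation.
\<close>

definition driving_filtration ::
    "'a measure \<Rightarrow> (real \<Rightarrow> 'a \<Rightarrow> real) \<Rightarrow> ('a \<Rightarrow> real) \<Rightarrow> real \<Rightarrow> 'a measure" where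
  "driving_filtration M B \<xi> t =
     sigma (space M)
       ({\<xi> -` A \<inter> space M | A. A \<in> sets borel} \<union>
        {B s -` A \<inter> space M | s A. s \<in> {0..t} \<and> A \<in> sets borel} \<union>
        null_sets M)"

definition strong_solution ::
    "'a measure \<Rightarrow> (real \<Rightarrow> 'a \<Rightarrow> real) \<Rightarrow> real set \<Rightarrow> (real \<Rightarrow> real) \<Rightarrow> (real \<Rightarrow> real) \<Rightarrow>
     (real \<Rightarrow> 'a \<Rightarrow> real) \<Rightarrow> bool" where
  "strong_solution M B I a b Y \<longleftrightarrow>
     process_on I M Y \<and>
     (\<forall>t\<in>I. Y t \<in> borel_measurable (driving_filtration M B (Y 0) t)) \<and>
     ae_continuous_on I M Y \<and>
     (\<forall>t\<in>I. \<exists>J. has_wiener_integral M B b 0 t J \<and>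
        (AE \<omega> in M. Y t \<omega> = Y 0 \<omega> + integral {0..t} (\<lambda>u. a u * Y u \<omega>) + J \<omega>))"


text \<open>Gaussian distributions, point masses included.\<close>

definition gaussian_rv :: "'a measure \<Rightarrow> ('a \<Rightarrow> real) \<Rightarrow> bool" where
  "gaussian_rv M \<xi> \<longleftrightarrow>
     (\<exists>m. AE \<omega> in M. \<xi> \<omega> = m) \<or>
     (\<exists>m s. s > 0 \<and> distributed M lborel \<xi> (normal_density m s))"

definition ou_type_process ::
    "'a measure \<Rightarrow> (real \<Rightarrow> 'a \<Rightarrow> real) \<Rightarrow> (real \<Rightarrow> real) \<Rightarrow> (real \<Rightarrow> real) \<Rightarrow>
     (real \<Rightarrow> 'a \<Rightarrow> real) \<Rightarrow> bool" where
  "ou_type_process M B q \<sigma> Z \<longleftrightarrow>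
     wiener_process M B \<and>
     continuous_on {0..} q \<and> continuous_on {0..} \<sigma> \<and> (\<forall>t\<ge>0. \<sigma> t \<noteq> 0) \<and>
     gaussian_rv M (Z 0) \<and>
     prob_space.indep_set M
       {Z 0 -` A \<inter> space M | A. A \<in> sets borel}
       {(\<lambda>\<omega>. \<lambda>t\<in>{0..}. B t \<omega>) -` E \<inter> space M | E. E \<in> sets (PiM {0..} (\<lambda>_. borel))} \<and>
     strong_solution M B {0..} q \<sigma> Z"

definition qbar :: "(real \<Rightarrow> real) \<Rightarrow> real \<Rightarrow> real" where
  "qbar q t = integral {0..t} q"

definition ou_gamma :: "(real \<Rightarrow> real) \<Rightarrow> (real \<Rightarrow> real) \<Rightarrow> real \<Rightarrow> real \<Rightarrow> real" where
  "ou_gamma q \<sigma> s t = integral {s..t} (\<lambda>u. exp (2 * (qbar q t - qbar q u)) * (\<sigma> u)\<^sup>2)"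

definition ou_bridge_integral ::
    "'a measure \<Rightarrow> (real \<Rightarrow> 'a \<Rightarrow> real) \<Rightarrow> (real \<Rightarrow> real) \<Rightarrow> (real \<Rightarrow> real) \<Rightarrow> real \<Rightarrow>
     (real \<Rightarrow> 'a \<Rightarrow> real) \<Rightarrow> bool" where
  "ou_bridge_integral M B q \<sigma> T U \<longleftrightarrow>
     process_on {0..T} M U \<and>
     (\<forall>t\<in>{0..<T}.
        has_wiener_integral M B
          (\<lambda>s. ou_gamma q \<sigma> t T / ou_gamma q \<sigma> s T * exp (qbar q t - qbar q s) * \<sigma> s) 0 t (U t)) \<and>
     (AE \<omega> in M. U T \<omega> = 0)"

text \<open>
  \<open>(M, B, q, \<sigma>)\<close> are the data of the Ornstein-Uhlenbeck type process; the bridge \<open>U\<close> may live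
  on another probability space \<open>N\<close>.  Likewise for the \<open>\<alpha>\<close>-Wiener bridge below.
\<close>

definition ou_bridge ::
    "'a measure \<Rightarrow> (real \<Rightarrow> 'a \<Rightarrow> real) \<Rightarrow> (real \<Rightarrow> real) \<Rightarrow> (real \<Rightarrow> real) \<Rightarrow> real \<Rightarrow>
     'b measure \<Rightarrow> (real \<Rightarrow> 'b \<Rightarrow> real) \<Rightarrow> bool" where
  "ou_bridge M B q \<sigma> T N U \<longleftrightarrow>
     process_on {0..T} N U \<and> ae_continuous_on {0..T} N U \<and>
     (\<exists>U'. ou_bridge_integral M B q \<sigma> T U' \<and> same_fdd {0..T} M U' N U)"

definition alpha_bridge_solution ::
    "'a measure \<Rightarrow> (real \<Rightarrow> 'a \<Rightarrow> real) \<Rightarrow> (real \<Rightarrow> real) \<Rightarrow> real \<Rightarrow> (real \<Rightarrow> 'a \<Rightarrow> real) \<Rightarrow> bool" where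
  "alpha_bridge_solution M B \<alpha> T X \<longleftrightarrow>
     wiener_process M B \<and>
     (AE \<omega> in M. X 0 \<omega> = 0) \<and>
     strong_solution M B {0..<T} (\<lambda>t. - (\<alpha> t / (T - t))) (\<lambda>_. 1) X"

definition alpha_wiener_bridge ::
    "'a measure \<Rightarrow> (real \<Rightarrow> 'a \<Rightarrow> real) \<Rightarrow> (real \<Rightarrow> real) \<Rightarrow> real \<Rightarrow>
     'b measure \<Rightarrow> (real \<Rightarrow> 'b \<Rightarrow> real) \<Rightarrow> bool" where
  "alpha_wiener_bridge M B \<alpha> T N X \<longleftrightarrow>
     process_on {0..<T} N X \<and> ae_continuous_on {0..<T} N X \<and>
     (\<exists>X'. alpha_bridge_solution M B \<alpha> T X' \<and> same_fdd {0..<T} M X' N X)"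

end

theory Submission
  imports Defs
begin

text \<open>
  Both bridges are Wiener integrals of separable kernels, so their covariances for \<open>s \<le> t\<close> are
  \<open>g(s) g(t) H(s)\<close> and \<open>k(s) k(t) L(s)\<close>, with \<open>g(t) = \<gamma>(t,T) exp (Q(t))\<close>, where \<open>Q(t) = \<integral>\<^sub>0\<^sup>t q\<close>, and \<open>k(t) = exp (- \<integral>\<^sub>0\<^sup>t \<alpha>(u) / (T - u) du)\<close>.  If they agree, then
  \<open>g\<close> is a constant multiple of \<open>k\<close>.  Comparing logarithmic derivatives gives
  \<open>\<alpha>(t) = (T - t) (\<phi>(t) / \<integral>\<^sub>t\<^sup>T \<phi> - q(t))\<close> with \<open>\<phi>\<close> continuous and positive at \<open>T\<close>, and
  this tends to \<open>1\<close>.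
\<close>

subsection \<open>Square integrable functions\<close>

text \<open>The two processes live on unrelated probability spaces, so only their finite-dimensional
  laws can be compared; the comparison is made on second moments, which the Ito isometry computes.
  The Ornstein-Uhlenbeck bridge comes with its kernel, but the \<alpha>-Wiener bridge is given as a
  solution of its equation, and its kernel has to be recovered by variation of constants. An
  integral is here a relation that asks for step functions converging in time together with their
  integrals converging on the probability space. Left-endpoint step functions on uniform grids
  provide them: their step integrals converge to the solution path by path.

  Proportionality of \<open>g\<close> and \<open>k\<close> comes from fixing the earlier time: as
  the later time varies, the covariance runs through a constant multiple of \<open>g\<close> on one
  side and of \<open>k\<close> on the other. The limit is 1 whatever the coefficients are, because
  \<open>q\<close> and \<sigma> are continuous at \<open>T\<close> and \<sigma> does not vanish
  there: the integral of \<phi> over \<open>[t, T]\<close> is asymptotic to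
  \<open>(T - t) * \<phi> T\<close>.\<close>

definition sq_integrable :: "'a measure \<Rightarrow> ('a \<Rightarrow> real) \<Rightarrow> bool" where
  "sq_integrable M f \<longleftrightarrow> f \<in> borel_measurable M \<and> integrable M (\<lambda>x. (f x)\<^sup>2)"

lemma sq_integrable_measurable: "sq_integrable M f \<Longrightarrow> f \<in> borel_measurable M"
  and sq_integrable_square: "sq_integrable M f \<Longrightarrow> integrable M (\<lambda>x. (f x)\<^sup>2)"
  by (auto simp: sq_integrable_def)

lemma sq_integrable_mult:
  assumes "sq_integrable M f" "sq_integrable M g"
  shows "integrable M (\<lambda>x. f x * g x)"
proof (rule Bochner_Integration.integrable_bound)
  show "integrable M (\<lambda>x. (f x)\<^sup>2 + (g x)\<^sup>2)"
    using assms by (auto simp: sq_integrable_def)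
  show "(\<lambda>x. f x * g x) \<in> borel_measurable M"
    using assms by (auto simp: sq_integrable_def)
  have "\<bar>a * b\<bar> \<le> a\<^sup>2 + b\<^sup>2" for a b :: real
  proof -
    have "2 * (\<bar>a\<bar> * \<bar>b\<bar>) \<le> a\<^sup>2 + b\<^sup>2"
      using sum_squares_bound[of "\<bar>a\<bar>" "\<bar>b\<bar>"] by (simp add: mult.assoc)
    moreover have "0 \<le> \<bar>a\<bar> * \<bar>b\<bar>" by simp
    ultimately show ?thesis unfolding abs_mult by linarith
  qed
  then show "AE x in M. norm (f x * g x) \<le> norm ((f x)\<^sup>2 + (g x)\<^sup>2)"
    by simp
qed

lemma sq_integrable_cmult: "sq_integrable M f \<Longrightarrow> sq_integrable M (\<lambda>x. c * f x)"
  by (auto simp: sq_integrable_def power_mult_distrib)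

lemma sq_integrable_add:
  assumes "sq_integrable M f" "sq_integrable M g"
  shows "sq_integrable M (\<lambda>x. f x + g x)"
  using assms sq_integrable_mult[OF assms]
  by (auto simp: sq_integrable_def power2_sum mult.assoc)

lemma sq_integrable_diff:
  assumes "sq_integrable M f" "sq_integrable M g"
  shows "sq_integrable M (\<lambda>x. f x - g x)"
  using sq_integrable_add[OF assms(1) sq_integrable_cmult[OF assms(2), of "-1"]] by simp

lemma sq_integrable_sum:
  assumes "finite I" "\<And>i. i \<in> I \<Longrightarrow> sq_integrable M (f i)"
  shows "sq_integrable M (\<lambda>x. \<Sum>i\<in>I. f i x)"
  using assms
proof (induction I)
  case empty
  show ?case by (simp add: sq_integrable_def)
next
  case (insert i I)
  then show ?case by (simp add: sq_integrable_add)
qed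

text \<open>The inequality for nonnegative extended integrals is applied to the absolute values and
  carried over to the reals, all three integrals being finite.\<close>

lemma Cauchy_Schwarz_sq_integrable:
  assumes f: "sq_integrable M f" and g: "sq_integrable M g"
  shows "\<bar>\<integral>x. f x * g x \<partial>M\<bar> \<le> sqrt (\<integral>x. (f x)\<^sup>2 \<partial>M) * sqrt (\<integral>x. (g x)\<^sup>2 \<partial>M)"
proof -
  note [measurable] = sq_integrable_measurable[OF f] sq_integrable_measurable[OF g]
  have fg: "integrable M (\<lambda>x. \<bar>f x\<bar> * \<bar>g x\<bar>)"
    using integrable_abs[OF sq_integrable_mult[OF f g]] by (simp add: abs_mult)
  have "(\<integral>\<^sup>+x. ennreal \<bar>f x\<bar> * ennreal \<bar>g x\<bar> \<partial>M)\<^sup>2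
      \<le> (\<integral>\<^sup>+x. (ennreal \<bar>f x\<bar>)\<^sup>2 \<partial>M) * (\<integral>\<^sup>+x. (ennreal \<bar>g x\<bar>)\<^sup>2 \<partial>M)"
    by (rule Cauchy_Schwarz_nn_integral) measurable
  also have "(\<integral>\<^sup>+x. (ennreal \<bar>f x\<bar>)\<^sup>2 \<partial>M) = ennreal (\<integral>x. (f x)\<^sup>2 \<partial>M)"
    by (simp add: ennreal_power nn_integral_eq_integral sq_integrable_square[OF f])
  also have "(\<integral>\<^sup>+x. (ennreal \<bar>g x\<bar>)\<^sup>2 \<partial>M) = ennreal (\<integral>x. (g x)\<^sup>2 \<partial>M)"
    by (simp add: ennreal_power nn_integral_eq_integral sq_integrable_square[OF g])
  also have "(\<integral>\<^sup>+x. ennreal \<bar>f x\<bar> * ennreal \<bar>g x\<bar> \<partial>M) = ennreal (\<integral>x. \<bar>f x\<bar> * \<bar>g x\<bar> \<partial>M)"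
    by (simp add: ennreal_mult[symmetric] nn_integral_eq_integral fg)
  finally have "(\<integral>x. \<bar>f x\<bar> * \<bar>g x\<bar> \<partial>M)\<^sup>2 \<le> (\<integral>x. (f x)\<^sup>2 \<partial>M) * (\<integral>x. (g x)\<^sup>2 \<partial>M)"
    by (simp add: ennreal_power ennreal_mult[symmetric])
  then have "(\<integral>x. \<bar>f x\<bar> * \<bar>g x\<bar> \<partial>M) \<le> sqrt ((\<integral>x. (f x)\<^sup>2 \<partial>M) * (\<integral>x. (g x)\<^sup>2 \<partial>M))"
    by (rule real_le_rsqrt)
  moreover have "\<bar>\<integral>x. f x * g x \<partial>M\<bar> \<le> (\<integral>x. \<bar>f x\<bar> * \<bar>g x\<bar> \<partial>M)"
    using integral_abs_bound[of M "\<lambda>x. f x * g x"] by (simp add: abs_mult)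
  ultimately show ?thesis by (simp add: real_sqrt_mult)
qed

text \<open>A single approximant at finite distance gives integrability, since \<open>f\<close> is
  the sum of it and the difference. The distances can then be read as real integrals.\<close>

lemma sq_integrable_L2_limit:
  assumes [measurable]: "f \<in> borel_measurable M" and fk: "\<And>k. sq_integrable M (fk k)"
    and lim: "(\<lambda>k. \<integral>\<^sup>+x. ennreal ((f x - fk k x)\<^sup>2) \<partial>M) \<longlonglongrightarrow> 0"
  shows "sq_integrable M f" "(\<lambda>k. \<integral>x. (f x - fk k x)\<^sup>2 \<partial>M) \<longlonglongrightarrow> 0"
proof -
  note [measurable] = sq_integrable_measurable[OF fk]
  have "eventually (\<lambda>k. (\<integral>\<^sup>+x. ennreal ((f x - fk k x)\<^sup>2) \<partial>M) < 1) sequentially"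
    using lim by (rule order_tendstoD) simp
  then obtain k where "(\<integral>\<^sup>+x. ennreal ((f x - fk k x)\<^sup>2) \<partial>M) < 1"
    by (auto simp: eventually_sequentially)
  then have "integrable M (\<lambda>x. (f x - fk k x)\<^sup>2)"
    by (intro integrableI_bounded) (auto intro: order.strict_trans)
  then have "sq_integrable M (\<lambda>x. (f x - fk k x))"
    by (simp add: sq_integrable_def)
  from sq_integrable_add[OF this fk[of k]] show f: "sq_integrable M f"
    by simp
  have "(\<integral>\<^sup>+x. ennreal ((f x - fk k x)\<^sup>2) \<partial>M) = ennreal (\<integral>x. (f x - fk k x)\<^sup>2 \<partial>M)" for k
    by (intro nn_integral_eq_integral sq_integrable_square sq_integrable_diff f fk) simp
  with lim show "(\<lambda>k. \<integral>x. (f x - fk k x)\<^sup>2 \<partial>M) \<longlonglongrightarrow> 0"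
    by (simp add: tendsto_ennreal_iff[where x=0, simplified])
qed

text \<open>With errors \<open>D k\<close> and \<open>E k\<close>, the product of the approximants
  is \<open>(f - D k) * (g - E k)\<close>; after expansion, Cauchy-Schwarz sends every term but
  \<open>f * g\<close> to zero.\<close>

lemma inner_tendsto_L2:
  assumes f: "f \<in> borel_measurable M" and fk: "\<And>k. sq_integrable M (fk k)"
    and limf: "(\<lambda>k. \<integral>\<^sup>+x. ennreal ((f x - fk k x)\<^sup>2) \<partial>M) \<longlonglongrightarrow> 0"
  assumes g: "g \<in> borel_measurable M" and gk: "\<And>k. sq_integrable M (gk k)"
    and limg: "(\<lambda>k. \<integral>\<^sup>+x. ennreal ((g x - gk k x)\<^sup>2) \<partial>M) \<longlonglongrightarrow> 0"
  shows "(\<lambda>k. \<integral>x. fk k x * gk k x \<partial>M) \<longlonglongrightarrow> (\<integral>x. f x * g x \<partial>M)"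
proof -
  note F = sq_integrable_L2_limit[OF f fk limf] and G = sq_integrable_L2_limit[OF g gk limg]
  define D where "D k x = f x - fk k x" for k x
  define E where "E k x = g x - gk k x" for k x
  have D: "sq_integrable M (D k)" and E: "sq_integrable M (E k)" for k
    using sq_integrable_diff[OF F(1) fk] sq_integrable_diff[OF G(1) gk]
    by (simp_all add: D_def[abs_def] E_def[abs_def])
  have D0: "(\<lambda>k. sqrt (\<integral>x. (D k x)\<^sup>2 \<partial>M)) \<longlonglongrightarrow> 0" and E0: "(\<lambda>k. sqrt (\<integral>x. (E k x)\<^sup>2 \<partial>M)) \<longlonglongrightarrow> 0"
    using tendsto_real_sqrt[OF F(2)] tendsto_real_sqrt[OF G(2)] by (simp_all add: D_def E_def)
  have 1: "(\<lambda>k. \<integral>x. D k x * E k x \<partial>M) \<longlonglongrightarrow> 0"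
    by (rule Lim_null_comparison[OF _ tendsto_mult_zero[OF D0 E0]])
       (auto intro!: always_eventually Cauchy_Schwarz_sq_integrable D E)
  have 2: "(\<lambda>k. \<integral>x. D k x * g x \<partial>M) \<longlonglongrightarrow> 0"
    by (rule Lim_null_comparison[OF _ tendsto_mult_left_zero[OF D0]])
       (auto intro!: always_eventually Cauchy_Schwarz_sq_integrable D G)
  have 3: "(\<lambda>k. \<integral>x. f x * E k x \<partial>M) \<longlonglongrightarrow> 0"
    by (rule Lim_null_comparison[OF _ tendsto_mult_right_zero[OF E0]])
       (auto intro!: always_eventually Cauchy_Schwarz_sq_integrable E F)
  have "(\<integral>x. fk k x * gk k x \<partial>M) =
      (\<integral>x. f x * g x \<partial>M) - (\<integral>x. D k x * g x \<partial>M) - (\<integral>x. f x * E k x \<partial>M) + (\<integral>x. D k x * E k x \<partial>M)" for k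
  proof -
    have "fk k x * gk k x = f x * g x - D k x * g x - f x * E k x + D k x * E k x" for x
      by (simp add: D_def E_def algebra_simps)
    then show ?thesis
      by (simp add: sq_integrable_mult D E F G)
  qed
  then show ?thesis
    using tendsto_add[OF tendsto_diff[OF tendsto_diff[OF tendsto_const[of "\<integral>x. f x * g x \<partial>M"] 2] 3] 1]
    by simp
qed

subsection \<open>Wiener integrals of deterministic functions\<close>

lemma wiener_process_prob_space: "wiener_process M B \<Longrightarrow> prob_space M"
  and wiener_process_measurable: "wiener_process M B \<Longrightarrow> 0 \<le> t \<Longrightarrow> B t \<in> borel_measurable M"
  by (auto simp: wiener_process_def process_on_def)

lemma wiener_increment:
  assumes W: "wiener_process M B" and st: "0 \<le> s" "s \<le> t"
  shows "sq_integrable M (\<lambda>\<omega>. B t \<omega> - B s \<omega>)" "(\<integral>\<omega>. (B t \<omega> - B s \<omega>)\<^sup>2 \<partial>M) = t - s"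
proof -
  interpret prob_space M using W by (rule wiener_process_prob_space)
  have [measurable]: "B s \<in> borel_measurable M" "B t \<in> borel_measurable M"
    using wiener_process_measurable[OF W] st by auto
  have "integrable M (\<lambda>\<omega>. (B t \<omega> - B s \<omega>)\<^sup>2) \<and> (\<integral>\<omega>. (B t \<omega> - B s \<omega>)\<^sup>2 \<partial>M) = t - s"
  \<comment> \<open>The increments have a density only for \<open>s < t\<close>; at
    \<open>s = t\<close> the increment is zero.\<close>
  proof (cases "s = t")
    case False
    with st have pos: "sqrt (t - s) > 0" by simp
    have D: "distributed M lborel (\<lambda>\<omega>. B t \<omega> - B s \<omega>) (normal_density 0 (sqrt (t - s)))"
      using W st False by (auto simp: wiener_process_def)
    have "integrable lborel (\<lambda>x. normal_density 0 (sqrt (t - s)) x * x\<^sup>2)"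
      using integrable_normal_moment[OF pos, of 0 2] by simp
    then have "integrable M (\<lambda>\<omega>. (B t \<omega> - B s \<omega>)\<^sup>2)"
      using distributed_integrable[OF D, of "\<lambda>x. x\<^sup>2"] by simp
    moreover have "(\<integral>\<omega>. (B t \<omega> - B s \<omega>)\<^sup>2 \<partial>M) = t - s"
      using normal_distributed_variance[OF pos D] normal_distributed_expectation[OF pos D] st
      by simp
    ultimately show ?thesis by simp
  qed simp
  then show "sq_integrable M (\<lambda>\<omega>. B t \<omega> - B s \<omega>)" "(\<integral>\<omega>. (B t \<omega> - B s \<omega>)\<^sup>2 \<partial>M) = t - s"
    by (auto simp: sq_integrable_def)
qed

text \<open>By polarization: only the variances of the increments enter, not their independence.\<close>

lemma wiener_increments_inner:
  assumes W: "wiener_process M B" and "0 \<le> a" "a \<le> b" "0 \<le> c" "c \<le> d"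
  shows "(\<integral>\<omega>. (B b \<omega> - B a \<omega>) * (B d \<omega> - B c \<omega>) \<partial>M) = max 0 (min b d - max a c)"
proof -
  define D where "D s t = (\<lambda>\<omega>. (B t \<omega> - B s \<omega>)\<^sup>2)" for s t
  \<comment> \<open>The absolute value covers both orders of the two times, so that the identity
    below serves for intervals in any relative position.\<close>
  have D: "integrable M (D s t)" "integral\<^sup>L M (D s t) = \<bar>t - s\<bar>" if "0 \<le> s" "0 \<le> t" for s t
  proof -
    have "integrable M (D s t) \<and> integral\<^sup>L M (D s t) = \<bar>t - s\<bar>"
    proof (cases "s \<le> t")
      case True
      then show ?thesis
        using wiener_increment[OF W \<open>0 \<le> s\<close> True] by (auto simp: sq_integrable_def D_def)
    next
      case False
      then have "t \<le> s" by simp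
      moreover have "D s t = D t s"
        by (auto simp: D_def power2_commute)
      ultimately show ?thesis
        using wiener_increment[OF W \<open>0 \<le> t\<close> \<open>t \<le> s\<close>] by (auto simp: sq_integrable_def D_def)
    qed
    then show "integrable M (D s t)" "integral\<^sup>L M (D s t) = \<bar>t - s\<bar>" by auto
  qed
  have "(B b \<omega> - B a \<omega>) * (B d \<omega> - B c \<omega>)
      = (D a d \<omega> + D b c \<omega> - D a c \<omega> - D b d \<omega>) / 2" for \<omega>
    by (simp add: D_def power2_eq_square algebra_simps)
  then have "(\<integral>\<omega>. (B b \<omega> - B a \<omega>) * (B d \<omega> - B c \<omega>) \<partial>M)
      = (\<integral>\<omega>. (D a d \<omega> + D b c \<omega> - D a c \<omega> - D b d \<omega>) / 2 \<partial>M)"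
    by (simp only:)
  also have "\<dots> = (\<bar>d - a\<bar> + \<bar>c - b\<bar> - \<bar>c - a\<bar> - \<bar>d - b\<bar>) / 2"
    using assms by (simp add: D)
  also have "\<dots> = max 0 (min b d - max a c)"
    using assms by (simp add: min_def max_def abs_real_def)
  finally show ?thesis .
qed

text \<open>The length of the overlap is also the expected product of the Brownian increments over
  the two intervals; this coincidence is the isometry on indicators.\<close>

lemma inner_indicator_Ioc:
  fixes a b c d :: real
  shows "(\<integral>u. indicator {a<..b} u * indicator {c<..d} u \<partial>lborel) = max 0 (min b d - max a c)"
proof -
  have "(\<integral>u. indicator {a<..b} u * indicator {c<..d} u \<partial>lborel)
      = (\<integral>u. indicator {max a c<..min b d} u \<partial>(lborel :: real measure) :: real)"
    by (intro Bochner_Integration.integral_cong) (auto simp: indicator_def)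
  then show ?thesis
    by (cases "max a c \<le> min b d") auto
qed

lemma sq_integrable_indicator_Ioc:
  "sq_integrable lborel (indicator {a<..b::real})"
proof (cases "a \<le> b")
  case True
  have "(\<lambda>x. (indicator {a<..b} x :: real)\<^sup>2) = indicator {a<..b}"
    by (auto simp: indicator_def)
  with True show ?thesis
    by (auto simp: sq_integrable_def intro!: integrable_real_indicator)
qed (simp add: sq_integrable_def)

lemma integral_double_sum:
  fixes F :: "'i \<Rightarrow> 'j \<Rightarrow> 'a \<Rightarrow> real"
  assumes "\<And>i j. i \<in> I \<Longrightarrow> j \<in> J \<Longrightarrow> integrable M (F i j)"
  shows "(\<integral>x. (\<Sum>i\<in>I. \<Sum>j\<in>J. a i j * F i j x) \<partial>M) = (\<Sum>i\<in>I. \<Sum>j\<in>J. a i j * integral\<^sup>L M (F i j))"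
  using assms by (simp add: Bochner_Integration.integral_sum Bochner_Integration.integrable_sum)

section \<open>Step functions on grids and the isometry\<close>

lemma step_grid_mono:
  assumes "step_grid a b n t" "i \<le> j" "j \<le> n"
  shows "t i \<le> t j"
  using assms(2,3)
proof (induction j rule: dec_induct)
  case (step k)
  then have "t k \<le> t (Suc k)" using assms(1) by (auto simp: step_grid_def)
  then show ?case using step by simp
qed simp

lemma step_grid_bounds:
  assumes "step_grid a b n t" "i \<le> n"
  shows "a \<le> t i" "t i \<le> b"
  using step_grid_mono[OF assms(1), of 0 i] step_grid_mono[OF assms(1), of i n] assms
  by (auto simp: step_grid_def)

lemma sq_integrable_step_fun: "sq_integrable lborel (step_fun n t c)"
  unfolding step_fun_def[abs_def]
  by (intro sq_integrable_sum sq_integrable_cmult sq_integrable_indicator_Ioc) auto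

lemma step_fun_supported:
  assumes "step_grid a b n t"
  shows "indicator {a..b} u * step_fun n t c u = step_fun n t c u"
  unfolding step_fun_def sum_distrib_left
proof (rule sum.cong)
  fix i assume "i \<in> {..<n}"
  then have "a \<le> t i" "t (Suc i) \<le> b"
    using step_grid_bounds[OF assms, of i] step_grid_bounds[OF assms, of "Suc i"] by auto
  then show "indicator {a..b} u * (c i * indicator {t i<..t (Suc i)} u) = c i * indicator {t i<..t (Suc i)} u"
    by (auto simp: indicator_def)
qed simp

lemma sq_integrable_step_integral:
  assumes "wiener_process M B" "step_grid a b n t" "0 \<le> a"
  shows "sq_integrable M (step_integral B n t c)"
  unfolding step_integral_def[abs_def]
proof (intro sq_integrable_sum sq_integrable_cmult wiener_increment(1)[OF assms(1)])
  fix i assume "i \<in> {..<n}"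
  then show "0 \<le> t i" "t i \<le> t (Suc i)"
    using step_grid_bounds(1)[OF assms(2), of i] assms by (auto simp: step_grid_def)
qed simp

text \<open>By bilinearity it is enough to compare one increment with one increment. The two grids
  may differ, so no common refinement has to be formed.\<close>

lemma step_integral_isometry:
  assumes W: "wiener_process M B"
    and t: "step_grid a b n t" "0 \<le> a" and s: "step_grid a' b' m s" "0 \<le> a'"
  shows "(\<integral>\<omega>. step_integral B n t c \<omega> * step_integral B m s d \<omega> \<partial>M)
       = (\<integral>u. step_fun n t c u * step_fun m s d u \<partial>lborel)"
proof -
  have t': "0 \<le> t i" "t i \<le> t (Suc i)" if "i \<in> {..<n}" for i
    using step_grid_bounds(1)[OF t(1), of i] t that by (auto simp: step_grid_def)
  have s': "0 \<le> s i" "s i \<le> s (Suc i)" if "i \<in> {..<m}" for i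
    using step_grid_bounds(1)[OF s(1), of i] s that by (auto simp: step_grid_def)
  have "(\<integral>\<omega>. step_integral B n t c \<omega> * step_integral B m s d \<omega> \<partial>M)
      = (\<integral>\<omega>. (\<Sum>i<n. \<Sum>j<m. c i * d j *
          ((B (t (Suc i)) \<omega> - B (t i) \<omega>) * (B (s (Suc j)) \<omega> - B (s j) \<omega>))) \<partial>M)"
    by (simp add: step_integral_def sum_product mult_ac)
  also have "\<dots> = (\<Sum>i<n. \<Sum>j<m. c i * d j * max 0 (min (t (Suc i)) (s (Suc j)) - max (t i) (s j)))"
    by (subst integral_double_sum)
       (auto simp: wiener_increments_inner[OF W] t' s'
         intro!: sq_integrable_mult wiener_increment(1)[OF W] t' s')
  also have "\<dots> = (\<integral>u. (\<Sum>i<n. \<Sum>j<m. c i * d j *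
          (indicator {t i<..t (Suc i)} u * indicator {s j<..s (Suc j)} u)) \<partial>lborel)"
    by (subst integral_double_sum)
       (auto simp: inner_indicator_Ioc intro!: sq_integrable_mult sq_integrable_indicator_Ioc)
  also have "\<dots> = (\<integral>u. step_fun n t c u * step_fun m s d u \<partial>lborel)"
    by (simp only: step_fun_def sum_product mult_ac)
  finally show ?thesis .
qed

text \<open>Inner products of the approximating step integrals equal those of the step functions;
  both sides converge, and limits are unique. The two intervals may differ because covariances at
  two times are wanted.\<close>

lemma wiener_integral_isometry:
  assumes W: "wiener_process M B" and "0 \<le> a" "0 \<le> a'"
    and J: "has_wiener_integral M B f a b J" and K: "has_wiener_integral M B g a' b' K"
  shows "sq_integrable M J" "sq_integrable M K"
    "(\<integral>\<omega>. J \<omega> * K \<omega> \<partial>M) = (\<integral>u. (indicator {a..b} u * f u) * (indicator {a'..b'} u * g u) \<partial>lborel)"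
proof -
  from J obtain n t c where J':
    "J \<in> borel_measurable M" "set_borel_measurable lborel {a..b} f"
    "\<And>k. step_grid a b (n k) (t k)"
    "(\<lambda>k. \<integral>\<^sup>+u\<in>{a..b}. ennreal ((f u - step_fun (n k) (t k) (c k) u)\<^sup>2) \<partial>lborel) \<longlonglongrightarrow> 0"
    "(\<lambda>k. \<integral>\<^sup>+\<omega>. ennreal ((J \<omega> - step_integral B (n k) (t k) (c k) \<omega>)\<^sup>2) \<partial>M) \<longlonglongrightarrow> 0"
    unfolding has_wiener_integral_def by blast
  from K obtain m s d where K':
    "K \<in> borel_measurable M" "set_borel_measurable lborel {a'..b'} g"
    "\<And>k. step_grid a' b' (m k) (s k)"
    "(\<lambda>k. \<integral>\<^sup>+u\<in>{a'..b'}. ennreal ((g u - step_fun (m k) (s k) (d k) u)\<^sup>2) \<partial>lborel) \<longlonglongrightarrow> 0"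
    "(\<lambda>k. \<integral>\<^sup>+\<omega>. ennreal ((K \<omega> - step_integral B (m k) (s k) (d k) \<omega>)\<^sup>2) \<partial>M) \<longlonglongrightarrow> 0"
    unfolding has_wiener_integral_def by blast
  \<comment> \<open>The integrand is extended by zero outside the interval, as the step function
    already is.\<close>
  have eq: "(\<integral>\<^sup>+u\<in>{a..b}. ennreal ((h u - step_fun n t c u)\<^sup>2) \<partial>lborel)
      = (\<integral>\<^sup>+u. ennreal ((indicator {a..b} u * h u - step_fun n t c u)\<^sup>2) \<partial>lborel)"
    if "step_grid a b n t" for a b h n t c
    by (subst step_fun_supported[OF that, symmetric])
       (auto intro!: nn_integral_cong simp: indicator_def)
  have fk: "(\<lambda>k. \<integral>\<^sup>+u. ennreal ((indicator {a..b} u * f u - step_fun (n k) (t k) (c k) u)\<^sup>2) \<partial>lborel) \<longlonglongrightarrow> 0"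
    using J'(4) by (simp add: eq[OF J'(3)])
  have gk: "(\<lambda>k. \<integral>\<^sup>+u. ennreal ((indicator {a'..b'} u * g u - step_fun (m k) (s k) (d k) u)\<^sup>2) \<partial>lborel) \<longlonglongrightarrow> 0"
    using K'(4) by (simp add: eq[OF K'(3)])
  have f: "(\<lambda>u. indicator {a..b} u * f u) \<in> borel_measurable lborel"
    and g: "(\<lambda>u. indicator {a'..b'} u * g u) \<in> borel_measurable lborel"
    using J'(2) K'(2) by (auto simp: set_borel_measurable_def)
  note SJ = sq_integrable_step_integral[OF W J'(3) \<open>0 \<le> a\<close>]
    and SK = sq_integrable_step_integral[OF W K'(3) \<open>0 \<le> a'\<close>]
  show "sq_integrable M J" "sq_integrable M K"
    by (rule sq_integrable_L2_limit(1)[OF J'(1) SJ J'(5)] sq_integrable_L2_limit(1)[OF K'(1) SK K'(5)])+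
  show "(\<integral>\<omega>. J \<omega> * K \<omega> \<partial>M) = (\<integral>u. (indicator {a..b} u * f u) * (indicator {a'..b'} u * g u) \<partial>lborel)"
    using inner_tendsto_L2[OF J'(1) SJ J'(5) K'(1) SK K'(5)]
      inner_tendsto_L2[OF f sq_integrable_step_fun fk g sq_integrable_step_fun gk]
    unfolding step_integral_isometry[OF W J'(3) \<open>0 \<le> a\<close> K'(3) \<open>0 \<le> a'\<close>]
    by (rule LIMSEQ_unique)
qed

text \<open>Expanding the expected square of \<open>J - K\<close> gives three inner products, and
  the isometry gives all of them the same value, with coefficients 1, -2 and 1.\<close>

lemma has_wiener_integral_unique:
  assumes W: "wiener_process M B" and a: "0 \<le> a"
    and J: "has_wiener_integral M B f a b J" and K: "has_wiener_integral M B f a b K"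
  shows "AE \<omega> in M. J \<omega> = K \<omega>"
proof -
  have sq: "sq_integrable M J" "sq_integrable M K"
    by (rule wiener_integral_isometry(1)[OF W a a J J] wiener_integral_isometry(1)[OF W a a K K])+
  have "(\<integral>\<omega>. (J \<omega> - K \<omega>)\<^sup>2 \<partial>M) = (\<integral>\<omega>. J \<omega> * J \<omega> - 2 * (J \<omega> * K \<omega>) + K \<omega> * K \<omega> \<partial>M)"
    by (intro Bochner_Integration.integral_cong) (auto simp: power2_eq_square algebra_simps)
  also have "\<dots> = (\<integral>\<omega>. J \<omega> * J \<omega> \<partial>M) - 2 * (\<integral>\<omega>. J \<omega> * K \<omega> \<partial>M) + (\<integral>\<omega>. K \<omega> * K \<omega> \<partial>M)"
    using sq by (simp add: sq_integrable_mult)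
  also have "\<dots> = 0"
    by (simp only: wiener_integral_isometry(3)[OF W a a J J] wiener_integral_isometry(3)[OF W a a J K]
        wiener_integral_isometry(3)[OF W a a K K])
  finally have "AE \<omega> in M. (J \<omega> - K \<omega>)\<^sup>2 = 0"
    by (subst (asm) integral_nonneg_eq_0_iff_AE)
       (auto intro: sq_integrable_square[OF sq_integrable_diff[OF sq]])
  then show ?thesis by simp
qed

lemma has_wiener_integral_one:
  assumes W: "wiener_process M B" and "0 \<le> t"
  shows "has_wiener_integral M B (\<lambda>_. 1) 0 t (\<lambda>\<omega>. B t \<omega> - B 0 \<omega>)"
  unfolding has_wiener_integral_def
proof (intro conjI exI allI)
  define g where "g i = (if i = 0 then 0 else t)" for i :: nat
  show "(\<lambda>\<omega>. B t \<omega> - B 0 \<omega>) \<in> borel_measurable M"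
    using wiener_increment(1)[OF W, of 0 t] \<open>0 \<le> t\<close> by (auto simp: sq_integrable_def)
  show "set_borel_measurable lborel {0..t} (\<lambda>_. 1::real)"
    by (simp add: set_borel_measurable_def)
  show "step_grid 0 t 1 g" for k :: nat
    using \<open>0 \<le> t\<close> by (simp add: step_grid_def g_def)
  \<comment> \<open>The cells are open on the left, so the step function is 0 instead of 1 at the
    point 0, which is a null set.\<close>
  have "(\<integral>\<^sup>+u\<in>{0..t}. ennreal ((1 - step_fun 1 g (\<lambda>_. 1) u)\<^sup>2) \<partial>lborel) = 0"
    using AE_lborel_singleton[of "0::real"]
    by (subst nn_integral_0_iff_AE) (auto simp: step_fun_def g_def indicator_def)
  then show "(\<lambda>k::nat. \<integral>\<^sup>+u\<in>{0..t}. ennreal ((1 - step_fun 1 g (\<lambda>_. 1) u)\<^sup>2) \<partial>lborel) \<longlonglongrightarrow> 0"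
    by simp
  show "(\<lambda>k::nat. \<integral>\<^sup>+\<omega>. ennreal (((B t \<omega> - B 0 \<omega>) - step_integral B 1 g (\<lambda>_. 1) \<omega>)\<^sup>2) \<partial>M) \<longlonglongrightarrow> 0"
    by (simp add: step_integral_def g_def)
qed

text \<open>Turns the stochastic equation with diffusion coefficient 1 into an integral equation
  driven by the path of \<open>B\<close>.\<close>

lemma wiener_integral_one_AE:
  assumes W: "wiener_process M B" and "0 \<le> t" and J: "has_wiener_integral M B (\<lambda>_. 1) 0 t J"
  shows "AE \<omega> in M. J \<omega> = B t \<omega>"
proof -
  have "AE \<omega> in M. B 0 \<omega> = 0" using W by (simp add: wiener_process_def)
  with has_wiener_integral_unique[OF W order_refl J has_wiener_integral_one[OF W \<open>0 \<le> t\<close>]]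
  show ?thesis by eventually_elim simp
qed

section \<open>Values of step functions and almost sure limits of step integrals\<close>

lemma step_fun_eq:
  assumes g: "step_grid a b n t" and i: "i < n" "t i < u" "u \<le> t (Suc i)"
  shows "step_fun n t c u = c i"
proof -
  have "indicator {t j<..t (Suc j)} u = (if j = i then 1 else 0 :: real)" if "j < n" for j
  proof -
    consider "j < i" | "j = i" | "i < j" by linarith
    then show ?thesis
    proof cases
      case 1
      then have "t (Suc j) \<le> t i" using i by (intro step_grid_mono[OF g]) auto
      with 1 i show ?thesis by auto
    next
      case 3
      then have "t (Suc i) \<le> t j" using that by (intro step_grid_mono[OF g]) auto
      with 3 i show ?thesis by auto
    qed (use i in auto)
  qed
  then have "step_fun n t c u = (\<Sum>j<n. c j * (if j = i then 1 else 0))"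
    unfolding step_fun_def by (intro sum.cong) auto
  also have "\<dots> = (\<Sum>j<n. if j = i then c j else 0)"
    by (intro sum.cong) auto
  also have "\<dots> = c i"
    using i(1) by simp
  finally show ?thesis .
qed

text \<open>The first index \<open>j\<close> with \<open>u \<le> t j\<close> is positive because
  \<open>t 0 < u\<close>; its predecessor is the index sought.\<close>

lemma grid_interval_exists:
  fixes t :: "nat \<Rightarrow> real"
  assumes "t 0 < u" "u \<le> t n"
  shows "\<exists>i<n. t i < u \<and> u \<le> t (Suc i)"
proof -
  define j where "j = (LEAST j. u \<le> t j)"
  have j: "u \<le> t j" "j \<le> n"
    using assms(2) by (auto simp: j_def intro: LeastI Least_le)
  then obtain i where i: "j = Suc i" using assms(1) by (cases j) auto
  have "\<not> u \<le> t i"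
    using i not_less_Least[of i "\<lambda>j. u \<le> t j"] by (simp add: j_def)
  with i j show ?thesis by (intro exI[of _ i]) auto
qed

text \<open>
  Almost sure convergence of the step integrals suffices: by Fatou's lemma and the isometry,
  the \<open>L\<^sup>2\<close> distance of \<open>J\<close> to a step integral is at most that of \<open>f\<close> to the step function.
\<close>

lemma has_wiener_integral_AE_limit:
  assumes W: "wiener_process M B" and a: "0 \<le> a"
    and [measurable]: "J \<in> borel_measurable M" and f: "set_borel_measurable lborel {a..b} f"
    and grid: "\<And>k. step_grid a b (n k) (t k)"
    and lim: "(\<lambda>k. \<integral>\<^sup>+u\<in>{a..b}. ennreal ((f u - step_fun (n k) (t k) (c k) u)\<^sup>2) \<partial>lborel) \<longlonglongrightarrow> 0"
    and AE_lim: "AE \<omega> in M. (\<lambda>k. step_integral B (n k) (t k) (c k) \<omega>) \<longlonglongrightarrow> J \<omega>"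
  shows "has_wiener_integral M B f a b J"
proof -
  define S where "S k = step_integral B (n k) (t k) (c k)" for k
  define F where "F k = step_fun (n k) (t k) (c k)" for k
  define f' where "f' u = indicator {a..b} u * f u" for u
  have S: "sq_integrable M (S k)" for k
    unfolding S_def by (rule sq_integrable_step_integral[OF W grid a])
  note [measurable] = sq_integrable_measurable[OF S]
  have F: "sq_integrable lborel (F k)" for k
    unfolding F_def by (rule sq_integrable_step_fun)
  have f'[measurable]: "f' \<in> borel_measurable lborel"
    using f by (simp add: f'_def[abs_def] set_borel_measurable_def)
  have eq: "(\<integral>\<^sup>+u\<in>{a..b}. ennreal ((f u - F k u)\<^sup>2) \<partial>lborel) = (\<integral>\<^sup>+u. ennreal ((f' u - F k u)\<^sup>2) \<partial>lborel)" for k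
    unfolding F_def f'_def
    by (subst step_fun_supported[OF grid, symmetric])
       (auto intro!: nn_integral_cong simp: indicator_def)
  have lim': "(\<lambda>k. \<integral>\<^sup>+u. ennreal ((f' u - F k u)\<^sup>2) \<partial>lborel) \<longlonglongrightarrow> 0"
    using lim by (simp add: eq[unfolded F_def] F_def)
  have iso: "(\<integral>\<omega>. (S m \<omega> - S k \<omega>)\<^sup>2 \<partial>M) = (\<integral>u. (F m u - F k u)\<^sup>2 \<partial>lborel)" for m k
  proof -
    have SF: "(\<integral>\<omega>. S i \<omega> * S j \<omega> \<partial>M) = (\<integral>u. F i u * F j u \<partial>lborel)" for i j
      unfolding S_def F_def by (rule step_integral_isometry[OF W grid a grid a])
    have "(\<integral>\<omega>. (S m \<omega> - S k \<omega>)\<^sup>2 \<partial>M) = (\<integral>\<omega>. S m \<omega> * S m \<omega> - 2 * (S m \<omega> * S k \<omega>) + S k \<omega> * S k \<omega> \<partial>M)"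
      by (intro Bochner_Integration.integral_cong) (auto simp: power2_eq_square algebra_simps)
    also have "\<dots> = (\<integral>u. F m u * F m u - 2 * (F m u * F k u) + F k u * F k u \<partial>lborel)"
      using S F by (simp add: sq_integrable_mult SF)
    also have "\<dots> = (\<integral>u. (F m u - F k u)\<^sup>2 \<partial>lborel)"
      by (intro Bochner_Integration.integral_cong) (auto simp: power2_eq_square algebra_simps)
    finally show ?thesis .
  qed
  have bound: "(\<integral>\<^sup>+\<omega>. ennreal ((J \<omega> - S k \<omega>)\<^sup>2) \<partial>M) \<le> (\<integral>\<^sup>+u. ennreal ((f' u - F k u)\<^sup>2) \<partial>lborel)" for k
  proof -
    have fk: "sq_integrable lborel (\<lambda>u. f' u - F k u)"
      by (intro sq_integrable_diff sq_integrable_L2_limit(1)[OF f' F lim'] F)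
    have "(\<integral>\<^sup>+\<omega>. ennreal ((J \<omega> - S k \<omega>)\<^sup>2) \<partial>M) = (\<integral>\<^sup>+\<omega>. liminf (\<lambda>m. ennreal ((S m \<omega> - S k \<omega>)\<^sup>2)) \<partial>M)"
    proof (rule nn_integral_cong_AE)
      show "AE \<omega> in M. ennreal ((J \<omega> - S k \<omega>)\<^sup>2) = liminf (\<lambda>m. ennreal ((S m \<omega> - S k \<omega>)\<^sup>2))"
        using AE_lim
      proof eventually_elim
        case (elim \<omega>)
        then have "(\<lambda>m. ennreal ((S m \<omega> - S k \<omega>)\<^sup>2)) \<longlonglongrightarrow> ennreal ((J \<omega> - S k \<omega>)\<^sup>2)"
          unfolding S_def by (intro tendsto_ennrealI tendsto_intros)
        then show ?case
          by (rule lim_imp_Liminf[OF trivial_limit_sequentially, symmetric])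
      qed
    qed
    also have "\<dots> \<le> liminf (\<lambda>m. \<integral>\<^sup>+\<omega>. ennreal ((S m \<omega> - S k \<omega>)\<^sup>2) \<partial>M)"
      by (rule nn_integral_liminf) measurable
    also have "(\<lambda>m. \<integral>\<^sup>+\<omega>. ennreal ((S m \<omega> - S k \<omega>)\<^sup>2) \<partial>M) = (\<lambda>m. ennreal (\<integral>u. (F m u - F k u)\<^sup>2 \<partial>lborel))"
      by (simp add: nn_integral_eq_integral[OF sq_integrable_square[OF sq_integrable_diff[OF S S]]] iso)
    also have "liminf \<dots> = ennreal (\<integral>u. (f' u - F k u)\<^sup>2 \<partial>lborel)"
    proof (rule lim_imp_Liminf)
      \<comment> \<open>A squared norm is the inner product of a sequence with itself, so the
        convergence of inner products applies, with \<open>m\<close> tending to infinity and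
        \<open>k\<close> fixed.\<close>
      have "(\<lambda>m. \<integral>u. (F m u - F k u) * (F m u - F k u) \<partial>lborel) \<longlonglongrightarrow> (\<integral>u. (f' u - F k u) * (f' u - F k u) \<partial>lborel)"
        by (rule inner_tendsto_L2)
           (use lim' fk in \<open>auto intro: sq_integrable_diff F dest: sq_integrable_measurable\<close>)
      then show "(\<lambda>m. ennreal (\<integral>u. (F m u - F k u)\<^sup>2 \<partial>lborel)) \<longlonglongrightarrow> ennreal (\<integral>u. (f' u - F k u)\<^sup>2 \<partial>lborel)"
        by (intro tendsto_ennrealI) (simp add: power2_eq_square)
    qed simp
    also have "\<dots> = (\<integral>\<^sup>+u. ennreal ((f' u - F k u)\<^sup>2) \<partial>lborel)"
      by (rule nn_integral_eq_integral[symmetric]) (auto intro: sq_integrable_square fk)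
    finally show ?thesis .
  qed
  have "(\<lambda>k. \<integral>\<^sup>+\<omega>. ennreal ((J \<omega> - S k \<omega>)\<^sup>2) \<partial>M) \<longlonglongrightarrow> 0"
    by (rule tendsto_sandwich[OF _ _ tendsto_const lim']) (auto intro: always_eventually bound)
  with f grid lim show ?thesis
    unfolding has_wiener_integral_def S_def by auto
qed

subsection \<open>Linear stochastic differential equations\<close>

text \<open>The index \<open>k\<close> stands for \<open>Suc k\<close> cells, so the denominator is
  never zero and every \<open>k\<close> gives a grid.\<close>

definition uniform_grid :: "real \<Rightarrow> nat \<Rightarrow> nat \<Rightarrow> real" where
  "uniform_grid t k i = real i * t / real (Suc k)"

lemma uniform_grid_0 [simp]: "uniform_grid t k 0 = 0"
  and uniform_grid_last [simp]: "uniform_grid t k (Suc k) = t"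
  and uniform_grid_diff: "uniform_grid t k (Suc i) - uniform_grid t k i = t / real (Suc k)"
  by (simp_all add: uniform_grid_def diff_divide_distrib[symmetric] left_diff_distrib[symmetric]
        del: of_nat_Suc)

lemma step_grid_uniform: "0 \<le> t \<Longrightarrow> step_grid 0 t (Suc k) (uniform_grid t k)"
  by (simp add: step_grid_def) (auto simp: uniform_grid_def divide_right_mono mult_right_mono)

lemma uniform_grid_mem:
  assumes "0 \<le> t" "i \<le> Suc k" shows "uniform_grid t k i \<in> {0..t}"
  using step_grid_bounds[OF step_grid_uniform[OF assms(1)] assms(2)] by simp

lemma uniform_grid_mesh: "(\<lambda>k. t / real (Suc k)) \<longlonglongrightarrow> 0"
  using LIMSEQ_Suc[OF lim_const_over_n[of t]] by simp

text \<open>The step function takes at \<open>u\<close> the value of \<open>f\<close> at the left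
  end of the cell containing \<open>u\<close>, which is within the mesh of \<open>u\<close>. The
  point 0 lies in no cell and is left out.\<close>

lemma step_fun_uniform_tendsto:
  fixes f :: "real \<Rightarrow> real"
  assumes f: "continuous_on {0..t} f" and u: "0 < u" "u \<le> t"
  shows "(\<lambda>k. step_fun (Suc k) (uniform_grid t k) (\<lambda>i. f (uniform_grid t k i)) u) \<longlonglongrightarrow> f u"
proof -
  have "\<exists>i<Suc k. uniform_grid t k i < u \<and> u \<le> uniform_grid t k (Suc i)" for k
    using grid_interval_exists[of "uniform_grid t k" u "Suc k"] u by auto
  then obtain i where i: "\<And>k. i k < Suc k" "\<And>k. uniform_grid t k (i k) < u"
      "\<And>k. u \<le> uniform_grid t k (Suc (i k))"
    by metis
  define p where "p k = uniform_grid t k (i k)" for k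
  have eq: "step_fun (Suc k) (uniform_grid t k) (\<lambda>i. f (uniform_grid t k i)) u = f (p k)" for k
    using u by (subst step_fun_eq[OF step_grid_uniform i]) (auto simp: p_def)
  have p: "p k \<in> {0..t}" for k
    using uniform_grid_mem[of t "i k" k] i(1)[of k] u by (simp add: p_def)
  have "norm (p k - u) \<le> t / real (Suc k)" for k
    using i(2)[of k] i(3)[of k] uniform_grid_diff[of t k "i k"] unfolding p_def by simp
  then have "(\<lambda>k. p k - u) \<longlonglongrightarrow> 0"
    by (intro Lim_null_comparison[OF _ uniform_grid_mesh]) (auto intro: always_eventually)
  then have "p \<longlonglongrightarrow> u"
    by (simp add: LIM_zero_iff)
  then have "(\<lambda>k. f (p k)) \<longlonglongrightarrow> f u"
    using f u p by (auto simp: continuous_on_sequentially o_def)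
  then show ?thesis by (simp add: eq)
qed

lemma step_fun_uniform_L2:
  fixes f :: "real \<Rightarrow> real"
  assumes f: "continuous_on {0..t} f" and t: "0 \<le> t"
  shows "(\<lambda>k. \<integral>\<^sup>+u\<in>{0..t}. ennreal ((f u -
      step_fun (Suc k) (uniform_grid t k) (\<lambda>i. f (uniform_grid t k i)) u)\<^sup>2) \<partial>lborel) \<longlonglongrightarrow> 0"
proof -
  define F where "F k = step_fun (Suc k) (uniform_grid t k) (\<lambda>i. f (uniform_grid t k i))" for k
  define f' where "f' u = indicator {0..t} u * f u" for u
  obtain C where "\<forall>y\<in>f ` {0..t}. norm y \<le> C"
    using compact_imp_bounded[OF compact_continuous_image[OF f compact_Icc]]
    unfolding bounded_iff by blast
  then have C: "\<bar>f u\<bar> \<le> C" if "u \<in> {0..t}" for u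
    using that by simp
  have [measurable]: "f' \<in> borel_measurable lborel" "F k \<in> borel_measurable lborel" for k
    using borel_measurable_continuous_on_indicator[OF _ f]
    using sq_integrable_measurable[OF sq_integrable_step_fun]
    by (auto simp: f'_def[abs_def] F_def[abs_def])
  have Fb: "\<bar>F k u\<bar> \<le> C" if "0 < u" "u \<le> t" for k u
  proof -
    have "\<exists>i<Suc k. uniform_grid t k i < u \<and> u \<le> uniform_grid t k (Suc i)"
      using that by (intro grid_interval_exists) auto
    then obtain i where "i < Suc k" "uniform_grid t k i < u" "u \<le> uniform_grid t k (Suc i)"
      by blast
    then have "F k u = f (uniform_grid t k i)" "i \<le> Suc k"
      unfolding F_def using step_fun_eq[OF step_grid_uniform[OF t]] by auto
    then show ?thesis using C uniform_grid_mem[OF t] by simp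
  qed
  have lim: "(\<lambda>k. indicator {0..t} u * (f' u - F k u)\<^sup>2) \<longlonglongrightarrow> 0" if "u \<noteq> 0" for u
  proof (cases "u \<in> {0..t}")
    case True
    then have "(\<lambda>k. f' u - F k u) \<longlonglongrightarrow> f' u - f u"
      unfolding F_def using that by (intro tendsto_intros step_fun_uniform_tendsto[OF f]) auto
    then have "(\<lambda>k. (f' u - F k u)\<^sup>2) \<longlonglongrightarrow> 0\<^sup>2"
      using True by (intro tendsto_power) (simp add: f'_def)
    then show ?thesis using True by simp
  qed simp
  have "(\<lambda>k. \<integral>\<^sup>+u. ennreal (indicator {0..t} u * (f' u - F k u)\<^sup>2) \<partial>lborel) \<longlonglongrightarrow> (\<integral>\<^sup>+(u::real). 0 \<partial>lborel)"
  \<comment> \<open>Both \<open>f\<close> and its step functions are bounded by \<open>C\<close> on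
    \<open>{0<..t}\<close>, whence the dominating constant \<open>(2 * C)\<^sup>2\<close>.\<close>
  proof (rule nn_integral_dominated_convergence[where w="\<lambda>u. ennreal ((2 * C)\<^sup>2) * indicator {0..t} u"])
    show "AE u in lborel. ennreal (indicator {0..t} u * (f' u - F k u)\<^sup>2) \<le> ennreal ((2 * C)\<^sup>2) * indicator {0..t} u" for k
      using AE_lborel_singleton[of "0::real"]
    proof eventually_elim
      case (elim u)
      show ?case
      proof (cases "u \<in> {0..t}")
        case True
        then have "\<bar>f' u - F k u\<bar> \<le> 2 * C"
          using elim C[of u] Fb[of u k] by (auto simp: f'_def)
        then have "(f' u - F k u)\<^sup>2 \<le> (2 * C)\<^sup>2"
          by (metis abs_ge_zero power2_abs power_mono)
        with True show ?thesis by (simp add: ennreal_leI)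
      qed simp
    qed
    show "(\<integral>\<^sup>+u. ennreal ((2 * C)\<^sup>2) * indicator {0..t} u \<partial>lborel) < \<infinity>"
      using t by (simp add: nn_integral_cmult_indicator ennreal_mult_less_top)
    show "AE u in lborel. (\<lambda>k. ennreal (indicator {0..t} u * (f' u - F k u)\<^sup>2)) \<longlonglongrightarrow> 0"
      using AE_lborel_singleton[of "0::real"]
    proof eventually_elim
      case (elim u)
      from tendsto_ennrealI[OF lim[OF this]] show ?case by simp
    qed
  qed measurable
  moreover have "(\<integral>\<^sup>+u\<in>{0..t}. ennreal ((f u - F k u)\<^sup>2) \<partial>lborel) = (\<integral>\<^sup>+u. ennreal (indicator {0..t} u * (f' u - F k u)\<^sup>2) \<partial>lborel)" for k
    by (auto intro!: nn_integral_cong simp: indicator_def f'_def)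
  ultimately show ?thesis
    by (simp add: F_def)
qed

text \<open>
  Since \<open>f' = - a f\<close>, the increment of \<open>f x\<close> over a grid interval differs from the corresponding term of
  the sum by the integral of \<open>a u (f (t i) x u - f u x (t (Suc i)))\<close>, where \<open>t\<close> is the grid.  The
  function \<open>(r, s) \<mapsto> f r x s\<close> is uniformly continuous, so these errors are small relative to the mesh.
\<close>

lemma euler_sum_tendsto:
  fixes x b a :: "real \<Rightarrow> real"
  assumes t: "0 \<le> t" and x: "continuous_on {0..t} x" and a: "continuous_on {0..t} a"
    and eq: "\<And>k i. i \<le> Suc k \<Longrightarrow>
      x (uniform_grid t k i) = integral {0..uniform_grid t k i} (\<lambda>u. a u * x u) + b (uniform_grid t k i)"
    and x0: "x 0 = 0"
  defines "f \<equiv> \<lambda>s. exp (integral {0..t} a - integral {0..s} a)"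
  shows "(\<lambda>k. \<Sum>i<Suc k. f (uniform_grid t k i) * (b (uniform_grid t k (Suc i)) - b (uniform_grid t k i))) \<longlonglongrightarrow> x t"
proof -
  have f_deriv: "(f has_real_derivative - (a s * f s)) (at s within {0..t})" if "s \<in> {0..t}" for s
    unfolding f_def
    by (rule derivative_eq_intros integral_has_real_derivative[OF a that] refl | simp)+
  then have f: "continuous_on {0..t} f"
    by (meson DERIV_continuous continuous_on_eq_continuous_within)
  define G where "G = (\<lambda>(r, s). f r * x s)"
  have "continuous_on ({0..t} \<times> {0..t}) G"
    unfolding G_def split_def
    by (intro continuous_intros continuous_on_compose2[OF f] continuous_on_compose2[OF x]) auto
  then have G: "uniformly_continuous_on ({0..t} \<times> {0..t}) G"
    by (intro compact_uniformly_continuous compact_Times) auto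
  obtain C where "\<forall>y\<in>a ` {0..t}. norm y \<le> C"
    using compact_imp_bounded[OF compact_continuous_image[OF a compact_Icc]]
    unfolding bounded_iff by blast
  then have C: "\<bar>a u\<bar> \<le> C" if "u \<in> {0..t}" for u
    using that by simp
  have C0: "0 \<le> C" using C[of 0] t by simp
  have ax: "continuous_on {0..t} (\<lambda>u. a u * x u)" and af: "continuous_on {0..t} (\<lambda>u. a u * f u)"
    by (intro continuous_intros a x f)+
  define S where "S k = (\<Sum>i<Suc k. f (uniform_grid t k i) * (b (uniform_grid t k (Suc i)) - b (uniform_grid t k i)))" for k
  show ?thesis
    unfolding S_def[symmetric]
  proof (rule LIMSEQ_I)
    fix r :: real assume "0 < r"
    \<comment> \<open>The accumulated error will be at most \<open>C * t * e\<close>; the summand 1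
      keeps the denominator positive when \<open>C * t\<close> is zero.\<close>
    define e where "e = r / (2 * (C * t + 1))"
    have Ct: "0 \<le> C * t" using C0 t by simp
    then have e: "0 < e" using \<open>0 < r\<close> by (simp add: e_def)
    obtain d where d: "0 < d" "\<And>p q. p \<in> {0..t} \<times> {0..t} \<Longrightarrow> q \<in> {0..t} \<times> {0..t} \<Longrightarrow> dist q p < d \<Longrightarrow> dist (G q) (G p) < e"
      using G e unfolding uniformly_continuous_on_def by blast
    \<comment> \<open>The points \<open>(u, g (Suc i))\<close> and \<open>(g i, u)\<close> differ in
      both coordinates, each time by at most the mesh, so half of \<open>d\<close> is asked
      for.\<close>
    obtain K where K: "\<And>k. k \<ge> K \<Longrightarrow> t / real (Suc k) < d / 2"
      using order_tendstoD(2)[OF uniform_grid_mesh[of t], of "d / 2"] d(1)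
      by (auto simp: eventually_sequentially)
    show "\<exists>K. \<forall>k\<ge>K. norm (S k - x t) < r"
    proof (intro exI allI impI)
      fix k assume "K \<le> k"
      define g where "g = uniform_grid t k"
      have g: "step_grid 0 t (Suc k) g" unfolding g_def by (rule step_grid_uniform[OF t])
      have g_diff: "g (Suc i) - g i = t / real (Suc k)" for i
        unfolding g_def by (rule uniform_grid_diff)
      have step_bound: "\<bar>f (g (Suc i)) * x (g (Suc i)) - f (g i) * x (g i) - f (g i) * (b (g (Suc i)) - b (g i))\<bar>
          \<le> C * e * (t / real (Suc k))" if i: "i < Suc k" for i
      proof -
        have gi: "0 \<le> g i" "g i \<le> g (Suc i)" "g (Suc i) \<le> t"
          using step_grid_bounds[OF g, of i] step_grid_bounds[OF g, of "Suc i"] g i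
          by (auto simp: step_grid_def)
        define I where "I = {g i..g (Suc i)}"
        have I: "I \<subseteq> {0..t}" using gi by (auto simp: I_def)
        have "integral {0..g (Suc i)} (\<lambda>u. a u * x u) = integral {0..g i} (\<lambda>u. a u * x u) + integral I (\<lambda>u. a u * x u)"
          unfolding I_def using gi
          by (intro Henstock_Kurzweil_Integration.integral_combine[symmetric] integrable_continuous_real
              continuous_on_subset[OF ax]) auto
        then have b: "b (g (Suc i)) - b (g i) = x (g (Suc i)) - x (g i) - integral I (\<lambda>u. a u * x u)"
          using eq[of i k] eq[of "Suc i" k] i by (simp add: g_def)
        have "((\<lambda>u. - (a u * f u)) has_integral f (g (Suc i)) - f (g i)) I"
          unfolding I_def
        proof (rule fundamental_theorem_of_calculus)
          fix s assume "s \<in> {g i..g (Suc i)}"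
          then show "(f has_vector_derivative - (a s * f s)) (at s within {g i..g (Suc i)})"
            using I unfolding has_real_derivative_iff_has_vector_derivative[symmetric] I_def
            by (intro DERIV_subset[OF f_deriv]) auto
        qed (use gi in auto)
        then have F: "((\<lambda>u. - (a u * f u) * x (g (Suc i))) has_integral (f (g (Suc i)) - f (g i)) * x (g (Suc i))) I"
          by (rule has_integral_mult_left)
        have "((\<lambda>u. a u * x u) has_integral integral I (\<lambda>u. a u * x u)) I"
          unfolding I_def using I by (intro integrable_integral integrable_continuous_real
              continuous_on_subset[OF ax]) (auto simp: I_def)
        then have "((\<lambda>u. f (g i) * (a u * x u)) has_integral f (g i) * integral I (\<lambda>u. a u * x u)) I"
          by (rule has_integral_mult_right)
        \<comment> \<open>Summation by parts on one cell: once the increment of \<open>b\<close> is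
          replaced through the equation, what remains is the increment of \<open>f\<close> times
          \<open>x (g (Suc i))\<close> plus \<open>f (g i)\<close> times the integral of
          \<open>a * x\<close>.\<close>
        from has_integral_add[OF F this]
        have H: "((\<lambda>u. - (a u * f u) * x (g (Suc i)) + f (g i) * (a u * x u)) has_integral
            f (g (Suc i)) * x (g (Suc i)) - f (g i) * x (g i) - f (g i) * (b (g (Suc i)) - b (g i))) I"
          unfolding b by (simp add: algebra_simps)
        have "norm (f (g (Suc i)) * x (g (Suc i)) - f (g i) * x (g i) - f (g i) * (b (g (Suc i)) - b (g i)))
            \<le> C * e * measure lborel (cbox (g i) (g (Suc i)))"
        proof (rule has_integral_bound)
          show "((\<lambda>u. - (a u * f u) * x (g (Suc i)) + f (g i) * (a u * x u)) has_integral
            f (g (Suc i)) * x (g (Suc i)) - f (g i) * x (g i) - f (g i) * (b (g (Suc i)) - b (g i))) (cbox (g i) (g (Suc i)))"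
            using H by (simp add: I_def)
          fix u assume "u \<in> cbox (g i) (g (Suc i))"
          then have u: "g i \<le> u" "u \<le> g (Suc i)" by auto
          have "dist (u, g (Suc i)) (g i, u) \<le> dist u (g i) + dist (g (Suc i)) u"
            by (simp add: dist_Pair_Pair sqrt_sum_squares_le_sum)
          also have "\<dots> \<le> 2 * (t / real (Suc k))"
            using u g_diff[of i] by (simp add: dist_real_def)
          also have "\<dots> < d" using K[OF \<open>K \<le> k\<close>] by linarith
          finally have "dist (G (u, g (Suc i))) (G (g i, u)) < e"
            using u gi by (intro d(2)) auto
          then have Gu: "\<bar>f (g i) * x u - f u * x (g (Suc i))\<bar> \<le> e"
            by (simp add: G_def dist_real_def abs_minus_commute)
          have "norm (- (a u * f u) * x (g (Suc i)) + f (g i) * (a u * x u))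
              = \<bar>a u\<bar> * \<bar>f (g i) * x u - f u * x (g (Suc i))\<bar>"
            by (simp add: abs_mult[symmetric] algebra_simps)
          also have "\<dots> \<le> C * e"
            using Gu C[of u] u gi C0 by (intro mult_mono) auto
          finally show "norm (- (a u * f u) * x (g (Suc i)) + f (g i) * (a u * x u)) \<le> C * e" .
        qed (use C0 e in auto)
        then show ?thesis using gi g_diff[of i] by simp
      qed
      have "(\<Sum>i<Suc k. f (g (Suc i)) * x (g (Suc i)) - f (g i) * x (g i)) = f (g (Suc k)) * x (g (Suc k)) - f (g 0) * x (g 0)"
        by (rule sum_lessThan_telescope)
      \<comment> \<open>The kernel \<open>f\<close> equals 1 at \<open>t\<close>, and
        \<open>x\<close> vanishes at 0.\<close>
      also have "\<dots> = x t"
        using x0 by (simp add: g_def f_def)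
      finally have "x t - S k = (\<Sum>i<Suc k. f (g (Suc i)) * x (g (Suc i)) - f (g i) * x (g i) - f (g i) * (b (g (Suc i)) - b (g i)))"
        unfolding S_def g_def[symmetric] by (simp only: sum_subtractf)
      also have "\<bar>\<dots>\<bar> \<le> (\<Sum>i<Suc k. C * e * (t / real (Suc k)))"
        by (intro order_trans[OF sum_abs] sum_mono step_bound) simp
      also have "\<dots> = C * t * e"
        by (simp add: field_simps del: of_nat_Suc)
      also have "\<dots> \<le> (C * t + 1) * e" using e by simp
      also have "\<dots> = r / 2" using Ct by (simp add: e_def field_simps)
      also have "\<dots> < r" using \<open>0 < r\<close> by simp
      finally show "norm (S k - x t) < r" by (simp add: abs_minus_commute)
    qed
  qed
qed

text \<open>Variation of constants. The step integrals of the sampled kernel are the sums that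
  converge to \<open>X t\<close> along almost every path, and almost sure convergence is enough to
  identify the integral. Continuity of \<open>a\<close> is asked for on \<open>{0..t}\<close> only,
  as the drift of the bridge may be singular at \<open>T\<close>.\<close>

lemma strong_solution_has_wiener_integral:
  fixes a :: "real \<Rightarrow> real"
  assumes W: "wiener_process M B" and X: "strong_solution M B I a (\<lambda>_. 1) X"
    and X0: "AE \<omega> in M. X 0 \<omega> = 0"
    and t: "0 \<le> t" "{0..t} \<subseteq> I" and a: "continuous_on {0..t} a"
  shows "has_wiener_integral M B (\<lambda>s. exp (integral {0..t} a - integral {0..s} a)) 0 t (X t)"
proof (rule has_wiener_integral_AE_limit[OF W order_refl])
  define f where "f s = exp (integral {0..t} a - integral {0..s} a)" for s
  have f: "continuous_on {0..t} f"
    unfolding f_def[abs_def]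
    by (intro continuous_intros indefinite_integral_continuous_1 integrable_continuous_real a)
  show "X t \<in> borel_measurable M"
    using X t by (auto simp: strong_solution_def process_on_def)
  show "set_borel_measurable lborel {0..t} f"
    using borel_measurable_continuous_on_indicator[OF _ f] by (simp add: set_borel_measurable_def)
  show "step_grid 0 t (Suc k) (uniform_grid t k)" for k
    by (rule step_grid_uniform[OF t(1)])
  show "(\<lambda>k. \<integral>\<^sup>+u\<in>{0..t}. ennreal ((f u -
      step_fun (Suc k) (uniform_grid t k) (\<lambda>i. f (uniform_grid t k i)) u)\<^sup>2) \<partial>lborel) \<longlonglongrightarrow> 0"
    by (rule step_fun_uniform_L2[OF f t(1)])
  have eq: "AE \<omega> in M. X s \<omega> = integral {0..s} (\<lambda>u. a u * X u \<omega>) + B s \<omega>" if s: "s \<in> {0..t}" for s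
  proof -
    from X s t(2) obtain J where J: "has_wiener_integral M B (\<lambda>_. 1) 0 s J"
      "AE \<omega> in M. X s \<omega> = X 0 \<omega> + integral {0..s} (\<lambda>u. a u * X u \<omega>) + J \<omega>"
      unfolding strong_solution_def by blast
    from s have "AE \<omega> in M. J \<omega> = B s \<omega>"
      by (intro wiener_integral_one_AE[OF W _ J(1)]) auto
    with J(2) X0 show ?thesis by eventually_elim simp
  qed
  \<comment> \<open>The equation holds almost surely at each fixed time; the points of all grids are
    countably many, so one null set serves for all of them.\<close>
  have "AE \<omega> in M. \<forall>k i. i \<le> Suc k \<longrightarrow> X (uniform_grid t k i) \<omega> =
      integral {0..uniform_grid t k i} (\<lambda>u. a u * X u \<omega>) + B (uniform_grid t k i) \<omega>"
    unfolding AE_all_countable using eq uniform_grid_mem[OF t(1)]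
    by (auto intro: eq simp del: uniform_grid_last)
  moreover have "AE \<omega> in M. continuous_on I (\<lambda>t. X t \<omega>)"
    using X by (simp add: strong_solution_def ae_continuous_on_def)
  ultimately show "AE \<omega> in M. (\<lambda>k. step_integral B (Suc k) (uniform_grid t k) (\<lambda>i. f (uniform_grid t k i)) \<omega>) \<longlonglongrightarrow> X t \<omega>"
    using X0
  proof eventually_elim
    case (elim \<omega>)
    show ?case
      unfolding step_integral_def f_def
      by (rule euler_sum_tendsto[OF t(1) continuous_on_subset[OF elim(2) t(2)] a])
         (use elim in auto)
  qed
qed

subsection \<open>Comparison of the covariances\<close>

lemma expectation_mult_eq_if_same_distr:
  assumes M: "process_on I M X" and N: "process_on I N Y" and st: "s \<in> I" "t \<in> I"
    and eq: "distr M (PiM {s, t} (\<lambda>_. borel)) (\<lambda>\<omega>. \<lambda>r\<in>{s, t}. X r \<omega>) =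
             distr N (PiM {s, t} (\<lambda>_. borel)) (\<lambda>\<omega>. \<lambda>r\<in>{s, t}. Y r \<omega>)"
  shows "(\<integral>\<omega>. X s \<omega> * X t \<omega> \<partial>M) = (\<integral>\<omega>. Y s \<omega> * Y t \<omega> \<partial>N)"
proof -
  \<comment> \<open>Stated for an arbitrary type of sample points, since it is applied to two
    different spaces.\<close>
  have *: "(\<integral>x. x s * x t \<partial>distr M (PiM {s, t} (\<lambda>_. borel)) (\<lambda>\<omega>. \<lambda>r\<in>{s, t}. X r \<omega>)) = (\<integral>\<omega>. X s \<omega> * X t \<omega> \<partial>M)"
    if "process_on I M X" for M :: "'z measure" and X :: "real \<Rightarrow> 'z \<Rightarrow> real"
  proof (subst integral_distr)
    show "(\<lambda>\<omega>. \<lambda>r\<in>{s, t}. X r \<omega>) \<in> measurable M (PiM {s, t} (\<lambda>_. borel))"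
      using that st by (intro measurable_restrict) (auto simp: process_on_def)
    show "(\<lambda>x. x s * x t) \<in> borel_measurable (PiM {s, t} (\<lambda>_. borel :: real measure))"
      by measurable
  qed simp
  show ?thesis using *[OF M] *[OF N] eq by simp
qed

text \<open>Both forms are needed: \<gamma> is a gauge integral, while the isometry yields Lebesgue
  integrals.\<close>

lemma lborel_integral_pos:
  fixes f :: "real \<Rightarrow> real"
  assumes f: "continuous_on {a..b} f" and "a < b" and pos: "\<And>x. x \<in> {a..b} \<Longrightarrow> 0 < f x"
  shows "0 < integral {a..b} f" "0 < (\<integral>x. indicator {a..b} x * f x \<partial>lborel)"
proof -
  have "integral {a..b} (\<lambda>_. 0) < integral {a..b} f"
    using assms by (intro integral_less_real) auto
  then show *: "0 < integral {a..b} f" by simp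
  have "(LINT x:{a..b}|lborel. f x) = integral {a..b} f"
    by (intro set_borel_integral_eq_integral borel_integrable_atLeastAtMost' f)
  with * show "0 < (\<integral>x. indicator {a..b} x * f x \<partial>lborel)"
    by (simp add: set_lebesgue_integral_def)
qed

text \<open>For \<open>s \<le> t\<close> the overlap of the two ranges of integration is
  \<open>{0..s}\<close>, so the later time enters only through the factor \<open>y\<close>.\<close>

lemma separable_wiener_integral_inner:
  assumes W: "wiener_process M B" and st: "0 \<le> s" "s \<le> t"
    and J: "has_wiener_integral M B (\<lambda>u. x * h u) 0 s J" and K: "has_wiener_integral M B (\<lambda>u. y * h u) 0 t K"
  shows "(\<integral>\<omega>. J \<omega> * K \<omega> \<partial>M) = x * y * (\<integral>u. indicator {0..s} u * (h u)\<^sup>2 \<partial>lborel)"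
proof -
  have "(\<integral>\<omega>. J \<omega> * K \<omega> \<partial>M) = (\<integral>u. (x * y) * (indicator {0..s} u * (h u)\<^sup>2) \<partial>lborel)"
    unfolding wiener_integral_isometry(3)[OF W order_refl order_refl J K]
    using st by (intro Bochner_Integration.integral_cong) (auto simp: indicator_def power2_eq_square)
  then show ?thesis by simp
qed

lemma DERIV_indefinite_integral:
  fixes f :: "real \<Rightarrow> real"
  assumes f: "continuous_on {a..b} f" and t: "a < t" "t < b"
  shows "((\<lambda>x. integral {a..x} f) has_real_derivative f t) (at t)"
  using integral_has_real_derivative[OF f, of t] t by (simp add: at_within_Icc_at)

theorem theorem3p7:
  fixes T :: real and \<alpha> :: "real \<Rightarrow> real"
  assumes "T > 0"
    and "continuous_on {0..<T} \<alpha>"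
    and "\<not> (\<alpha> \<longlongrightarrow> 1) (at_left T)"
  shows "\<not> (\<exists>(M :: 'a measure) B q \<sigma> Z (N :: 'b measure) U
              (P :: 'c measure) W (R :: 'd measure) X.
            ou_type_process M B q \<sigma> Z \<and>
            ou_bridge M B q \<sigma> T N U \<and>
            alpha_wiener_bridge P W \<alpha> T R X \<and>
            same_fdd {0..<T} N U R X)"
proof
  assume "\<exists>(M :: 'a measure) B q \<sigma> Z (N :: 'b measure) U (P :: 'c measure) W (R :: 'd measure) X.
            ou_type_process M B q \<sigma> Z \<and> ou_bridge M B q \<sigma> T N U \<and>
            alpha_wiener_bridge P W \<alpha> T R X \<and> same_fdd {0..<T} N U R X"
  then obtain M :: "'a measure" and B q \<sigma> Z and N :: "'b measure" and U
    and P :: "'c measure" and W and R :: "'d measure" and X where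
    ou: "ou_type_process M B q \<sigma> Z" and bridge: "ou_bridge M B q \<sigma> T N U" and
    alpha: "alpha_wiener_bridge P W \<alpha> T R X" and same: "same_fdd {0..<T} N U R X"
    by blast
  obtain U' where U': "ou_bridge_integral M B q \<sigma> T U'" "same_fdd {0..T} M U' N U"
    using bridge by (auto simp: ou_bridge_def)
  obtain X' where X': "alpha_bridge_solution P W \<alpha> T X'" "same_fdd {0..<T} P X' R X"
    using alpha by (auto simp: alpha_wiener_bridge_def)
  have B: "wiener_process M B" and q: "continuous_on {0..} q" and \<sigma>: "continuous_on {0..} \<sigma>"
    and \<sigma>_nz: "\<And>t. 0 \<le> t \<Longrightarrow> \<sigma> t \<noteq> 0"
    using ou by (auto simp: ou_type_process_def)
  have W: "wiener_process P W"
    using X' by (simp add: alpha_bridge_solution_def)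
  define a where "a t = - (\<alpha> t / (T - t))" for t
  have a: "continuous_on {0..<T} a"
    unfolding a_def[abs_def] by (intro continuous_intros assms(2)) auto
  define A where "A t = integral {0..t} a" for t
  define \<phi> where "\<phi> u = exp (2 * (qbar q T - qbar q u)) * (\<sigma> u)\<^sup>2" for u
  define G where "G t = integral {t..T} \<phi>" for t
  have G_eq: "ou_gamma q \<sigma> t T = G t" for t
    by (simp add: G_def \<phi>_def[abs_def] ou_gamma_def)
  have qT: "continuous_on {0..T} q" and \<sigma>T: "continuous_on {0..T} \<sigma>"
    using q \<sigma> by (auto intro: continuous_on_subset)
  have qbar: "continuous_on {0..T} (qbar q)"
    unfolding qbar_def[abs_def]
    by (intro indefinite_integral_continuous_1 integrable_continuous_real qT)
  have \<phi>: "continuous_on {0..T} \<phi>"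
    unfolding \<phi>_def[abs_def] by (intro continuous_intros qbar \<sigma>T)
  \<comment> \<open>This includes \<open>u = T\<close>, where the value becomes the denominator of
    the final limit.\<close>
  have \<phi>_pos: "0 < \<phi> u" if "0 \<le> u" for u
    using \<sigma>_nz[OF that] by (simp add: \<phi>_def)
  have G_pos: "0 < G t" if "0 \<le> t" "t < T" for t
    unfolding G_def using that
    by (intro lborel_integral_pos continuous_on_subset[OF \<phi>] \<phi>_pos) auto
  \<comment> \<open>Moves the variable to the upper limit of integration, where the integral can be
    differentiated.\<close>
  have G_split: "G t = G 0 - integral {0..t} \<phi>" if "0 \<le> t" "t \<le> T" for t
    using Henstock_Kurzweil_Integration.integral_combine[OF that, of \<phi>] \<phi>
    by (simp add: G_def integrable_continuous_real)
  have A_cont: "continuous_on {0..t} A" if "t < T" for t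
    unfolding A_def[abs_def] using that
    by (intro indefinite_integral_continuous_1 integrable_continuous_real continuous_on_subset[OF a]) auto

  define g where "g t = G t * exp (qbar q t)" for t
  define h where "h u = \<sigma> u / (G u * exp (qbar q u))" for u
  define k where "k t = exp (A t)" for t
  define m where "m u = exp (- A u)" for u
  define H where "H s = (\<integral>u. indicator {0..s} u * (h u)\<^sup>2 \<partial>lborel)" for s
  define L where "L s = (\<integral>u. indicator {0..s} u * (m u)\<^sup>2 \<partial>lborel)" for s

  have U'_int: "has_wiener_integral M B (\<lambda>u. g t * h u) 0 t (U' t)" if "t \<in> {0..<T}" for t
  proof -
    \<comment> \<open>An equality on the whole line: where \<open>G u\<close> is zero, division by
      zero makes both sides zero.\<close>
    have "(\<lambda>u. ou_gamma q \<sigma> t T / ou_gamma q \<sigma> u T * exp (qbar q t - qbar q u) * \<sigma> u) = (\<lambda>u. g t * h u)"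
      by (simp add: g_def h_def G_eq exp_diff field_simps)
    then show ?thesis
      using U'(1) that unfolding ou_bridge_integral_def by metis
  qed
  have X'_int: "has_wiener_integral P W (\<lambda>u. k t * m u) 0 t (X' t)" if "t \<in> {0..<T}" for t
  proof -
    have "has_wiener_integral P W (\<lambda>u. exp (integral {0..t} a - integral {0..u} a)) 0 t (X' t)"
      using X'(1) that unfolding alpha_bridge_solution_def a_def[symmetric]
      by (intro strong_solution_has_wiener_integral[OF W, where I="{0..<T}"] continuous_on_subset[OF a]) auto
    then show ?thesis
      by (simp add: k_def m_def A_def[symmetric] exp_add[symmetric])
  qed

  have cov: "g s * g t * H s = k s * k t * L s" if st: "0 \<le> s" "s \<le> t" "t < T" for s t
  proof -
    have J: "finite {s, t} \<and> {s, t} \<subseteq> {0..<T}" "finite {s, t} \<and> {s, t} \<subseteq> {0..T}"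
      using st by auto
    \<comment> \<open>\<open>U'\<close> and \<open>X'\<close> live on the spaces of their Wiener
      processes; their joint laws are linked through \<open>U\<close> and \<open>X\<close>.\<close>
    have "distr M (PiM {s, t} (\<lambda>_. borel)) (\<lambda>\<omega>. \<lambda>r\<in>{s, t}. U' r \<omega>)
        = distr P (PiM {s, t} (\<lambda>_. borel)) (\<lambda>\<omega>. \<lambda>r\<in>{s, t}. X' r \<omega>)"
      using U'(2)[unfolded same_fdd_def, rule_format, OF J(2)] same[unfolded same_fdd_def, rule_format, OF J(1)]
        X'(2)[unfolded same_fdd_def, rule_format, OF J(1)] by simp
    moreover have "process_on {0..<T} M U'"
      using U'(1) by (auto simp: ou_bridge_integral_def process_on_def)
    moreover have "process_on {0..<T} P X'"
      using X'(1) by (auto simp: alpha_bridge_solution_def strong_solution_def)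
    ultimately have "(\<integral>\<omega>. U' s \<omega> * U' t \<omega> \<partial>M) = (\<integral>\<omega>. X' s \<omega> * X' t \<omega> \<partial>P)"
      using st by (intro expectation_mult_eq_if_same_distr) auto
    then show ?thesis
      using separable_wiener_integral_inner[OF B st(1,2) U'_int U'_int]
        separable_wiener_integral_inner[OF W st(1,2) X'_int X'_int] st
      by (simp add: H_def L_def)
  qed

  have L_pos: "0 < L s" if "0 < s" "s < T" for s
    unfolding L_def m_def
    using that by (intro lborel_integral_pos(2) continuous_intros A_cont) auto
  have g_pos: "0 < g t" if "0 \<le> t" "t < T" for t
    using G_pos[OF that] by (simp add: g_def)

  \<comment> \<open>Any point strictly between 0 and \<open>T\<close> would do: \<open>L s\<close>
    must be positive, and a limit at \<open>T\<close> only concerns later times.\<close>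
  define s where "s = T / 2"
  have s: "0 < s" "s < T" using \<open>T > 0\<close> by (auto simp: s_def)
  define C where "C = g s / k s"
  have gk: "g t = C * k t" if t: "s \<le> t" "t < T" for t
  proof -
    \<comment> \<open>The identity at \<open>(s, s)\<close> transfers nonvanishing from
      \<open>L\<close> to \<open>H\<close>, so \<open>h\<close> need not be analysed.\<close>
    have H0: "H s \<noteq> 0"
      using cov[of s s] L_pos[OF s] s by (auto simp: k_def)
    have "(g s * H s) * (g t * k s) = (g s * g t * H s) * k s"
      by (simp only: mult_ac)
    also have "\<dots> = (k s * k s * L s) * k t"
      using s t by (simp only: cov[of s t]) (simp only: mult_ac)
    also have "\<dots> = (g s * g s * H s) * k t"
      using s by (simp only: cov[of s s])
    also have "\<dots> = (g s * H s) * (g s * k t)"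
      by (simp only: mult_ac)
    finally have "(g s * H s) * (g t * k s) = (g s * H s) * (g s * k t)" .
    then have "g t * k s = g s * k t"
      using H0 g_pos[of s] s by simp
    then show ?thesis by (simp add: C_def k_def field_simps)
  qed

  have \<alpha>_eq: "\<alpha> t = \<phi> t / (G t / (T - t)) - (T - t) * q t" if t: "s < t" "t < T" for t
  proof -
    have "(A has_real_derivative a t) (at t)"
      unfolding A_def[abs_def] using t s
      \<comment> \<open>The midpoint of \<open>t\<close> and \<open>T\<close> serves as right end
        because \<open>a\<close> is known to be continuous only before \<open>T\<close>.\<close>
      by (intro DERIV_indefinite_integral[where b="(t + T) / 2"] continuous_on_subset[OF a]) auto
    then have "((\<lambda>t. C * k t) has_real_derivative C * (k t * a t)) (at t)"
      unfolding k_def by (auto intro!: derivative_eq_intros)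
    \<comment> \<open>Equal derivatives require equality near \<open>t\<close>, hence the strict
      inequality \<open>s < t\<close>.\<close>
    moreover have "eventually (\<lambda>x. C * k x = g x) (nhds t)"
      by (rule eventually_mono[OF eventually_nhds_in_open[of "{s<..<T}" t]])
         (use t in \<open>auto intro: gk[symmetric]\<close>)
    ultimately have "(g has_real_derivative g t * a t) (at t)"
      using DERIV_cong_ev[OF refl _ refl, of "\<lambda>t. C * k t" g t] t
      by (subst gk) (simp_all only: mult.assoc less_imp_le)
    moreover have "(g has_real_derivative - \<phi> t * exp (qbar q t) + G t * (exp (qbar q t) * q t)) (at t)"
    proof -
      have "((\<lambda>t. G 0 - integral {0..t} \<phi>) has_real_derivative - \<phi> t) (at t)"
        using t s by (auto intro!: derivative_eq_intros DERIV_indefinite_integral[OF \<phi>])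
      moreover have "eventually (\<lambda>x. G 0 - integral {0..x} \<phi> = G x) (nhds t)"
        by (rule eventually_mono[OF eventually_nhds_in_open[of "{s<..<T}" t]])
           (use t s in \<open>auto intro: G_split[symmetric]\<close>)
      ultimately have "(G has_real_derivative - \<phi> t) (at t)"
        using DERIV_cong_ev[OF refl _ refl, of "\<lambda>t. G 0 - integral {0..t} \<phi>" G t] by simp
      moreover have "(qbar q has_real_derivative q t) (at t)"
        unfolding qbar_def[abs_def] using t s by (intro DERIV_indefinite_integral[OF qT]) auto
      ultimately show ?thesis
        unfolding g_def[abs_def] by (auto intro!: derivative_eq_intros)
    qed
    ultimately have "g t * a t = - \<phi> t * exp (qbar q t) + G t * (exp (qbar q t) * q t)"
      by (rule DERIV_unique)
    then have "exp (qbar q t) * (G t * a t) = exp (qbar q t) * (G t * q t - \<phi> t)"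
      by (simp add: g_def algebra_simps)
    then have "G t * a t = G t * q t - \<phi> t"
      by simp
    then show ?thesis
      using G_pos[of t] t s by (simp add: a_def field_simps)
  qed

  have at_left: "at T within {0..T} = at_left T"
    using \<open>T > 0\<close> by (rule at_within_Icc_at_left)
  \<comment> \<open>The quotient \<open>G t / (T - t)\<close> is a difference quotient of the
    indefinite integral of \<phi> at \<open>T\<close>, so it tends to
    \<open>\<phi> T\<close>.\<close>
  have "((\<lambda>x. integral {0..x} \<phi>) has_real_derivative \<phi> T) (at T within {0..T})"
    using \<open>T > 0\<close> by (intro integral_has_real_derivative[OF \<phi>]) auto
  then have "((\<lambda>t. (integral {0..t} \<phi> - integral {0..T} \<phi>) / (t - T)) \<longlongrightarrow> \<phi> T) (at_left T)"
    by (simp add: has_field_derivative_iff at_left)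
  moreover have interval: "eventually (\<lambda>t. s < t \<and> t < T) (at_left T)"
    using eventually_at_left_real[OF s(2)] by (auto elim!: eventually_mono)
  then have "eventually (\<lambda>t. (integral {0..t} \<phi> - integral {0..T} \<phi>) / (t - T) = G t / (T - t)) (at_left T)"
  proof eventually_elim
    case (elim t)
    then have "integral {0..t} \<phi> - integral {0..T} \<phi> = - G t"
      using G_split[of t] G_split[of T] s by (simp add: G_def)
    then show ?case
      using elim by (simp only:) (simp add: field_simps)
  qed
  ultimately have "((\<lambda>t. G t / (T - t)) \<longlongrightarrow> \<phi> T) (at_left T)"
    by (rule Lim_transform_eventually)
  \<comment> \<open>Continuity of \<open>q\<close> at \<open>T\<close> makes the term
    \<open>(T - t) * q t\<close> vanish in the limit.\<close>
  moreover have "(\<phi> \<longlongrightarrow> \<phi> T) (at_left T)" "(q \<longlongrightarrow> q T) (at_left T)"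
    using \<phi> qT \<open>T > 0\<close> by (auto simp: continuous_on_def at_left[symmetric])
  ultimately have "((\<lambda>t. \<phi> t / (G t / (T - t)) - (T - t) * q t) \<longlongrightarrow> \<phi> T / \<phi> T - (T - T) * q T) (at_left T)"
    using \<phi>_pos[of T] \<open>T > 0\<close> by (intro tendsto_intros) auto
  then have "((\<lambda>t. \<phi> t / (G t / (T - t)) - (T - t) * q t) \<longlongrightarrow> 1) (at_left T)"
    using \<phi>_pos[of T] \<open>T > 0\<close> by simp
  moreover have "eventually (\<lambda>t. \<phi> t / (G t / (T - t)) - (T - t) * q t = \<alpha> t) (at_left T)"
    using interval by eventually_elim (simp add: \<alpha>_eq)
  ultimately have "(\<alpha> \<longlongrightarrow> 1) (at_left T)"
    by (rule Lim_transform_eventually)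
  with assms(3) show False by contradiction
qed

end
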